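(* Let $c$ be a real number with $1<c<e$, where $e=2.718\ldots$ is Euler's number, and let $k\geq 0$ be an integer. Then there is a number $N_k$ such that for all positive integers $n\geq N_k$, $$\prod_{j\leq n}p_j>c^{\,p_{n+k}}.$$
   Context: Here $p_m$ denotes the $m$-th prime number ($p_1=2$, $p_2=3$, ...), and $\prod_{j\leq n}p_j=p_1p_2\cdots p_n$ is the product of the first $n$ primes. The number $N_k$ may depend on both $c$ and $k$. *)

theory Defs
  imports Complex_Main "HOL-Library.Infinite_Set" "HOL-Computational_Algebra.Primes"
begin

text \<open>
  Primes are indexed from 1, so \<open>nth_prime 1 = 2\<close> and \<open>nth_prime 2 = 3\<close>, whereas
  \<^const>\<open>enumerate\<close> counts from 0. Because of truncated subtraction, \<open>nth_prime 0\<close> is a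
  junk value (equal to \<open>nth_prime 1\<close>).
\<close>

definition nth_prime :: "nat \<Rightarrow> nat" where
  "nth_prime m = enumerate {p::nat. prime p} (m - 1)"

lemma prime_nth_prime: "prime (nth_prime m)"
  using enumerate_in_set[OF primes_infinite] by (simp add: nth_prime_def)

lemma strict_mono_on_nth_prime: "strict_mono_on {1..} nth_prime"
  by (rule strict_mono_onI)
     (simp add: nth_prime_def enumerate_mono[OF _ primes_infinite] diff_less_mono)

lemma nth_prime_image: "nth_prime ` {1..} = {p. prime p}"
proof -
  have "nth_prime ` {1..} = range (enumerate {p::nat. prime p})"
  proof (intro equalityI subsetI)
    fix x assume "x \<in> range (enumerate {p::nat. prime p})"
    then obtain i where "x = enumerate {p::nat. prime p} i" by blast
    then have "x = nth_prime (Suc i)" by (simp add: nth_prime_def)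
    then show "x \<in> nth_prime ` {1..}" by simp
  qed (auto simp: nth_prime_def)
  then show ?thesis using range_enumerate[OF primes_infinite] by simp
qed

lemma nth_prime_1: "nth_prime 1 = 2"
proof -
  have "(LEAST p::nat. prime p) = 2"
    by (rule Least_equality) (auto dest: prime_ge_2_nat)
  then show ?thesis by (simp add: nth_prime_def enumerate_0)
qed

end

theory Submission
  imports
    Defs
    "HOL-Complex_Analysis.Complex_Analysis"
    "HOL-Number_Theory.Prime_Powers"
    "HOL-Real_Asymp.Real_Asymp"
begin

text \<open>
  Taking logarithms, the claim is \<open>\<theta>(p\<^sub>n) > p\<^sub>n\<^sub>+\<^sub>k ln c\<close>, where \<open>\<theta>(x)\<close> is the sum of \<open>ln p\<close> over the
  primes \<open>p \<le> x\<close>. Since \<open>\<theta>(p\<^sub>n)\<close> and \<open>\<theta>(p\<^sub>n\<^sub>+\<^sub>k)\<close> differ by at most \<open>k ln p\<^sub>n\<^sub>+\<^sub>k\<close> and \<open>ln c < 1\<close>, it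
  suffices to know the lower half of the prime number theorem: \<open>\<theta>(x) \<ge> (1 - \<epsilon>) x\<close> for all large
  \<open>x\<close> (lemma \<open>theta_lower_bound\<close>). The upper half is not needed.

  The lower half follows the method of Wiener and Ikehara. The function \<open>(s - 1) \<zeta>(s)\<close> extends
  holomorphically to \<open>Re s > 0\<close> and has no zero on \<open>Re s \<ge> 1\<close> (lemma \<open>zetaC_nonzero\<close>), so the series
  \<open>\<Sum> \<Lambda>(n) / n\<^sup>s\<close> is \<open>1 / (s - 1)\<close> plus a function \<open>H\<close> that is holomorphic near \<open>Re s = 1\<close>. Let
  \<open>w\<close> be the cosine transform of a function on \<open>[0, 1]\<close>, let \<open>l > 0\<close>, and consider the sum of
  \<open>\<Lambda>(n) / n * w (l (ln n - T))\<close>. The function \<open>H\<close> contributes an oscillating integral over a segment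
  of \<open>Re s = 1\<close>, which tends to 0 as \<open>T\<close> grows, and the pole contributes approximately the integral
  of \<open>w\<close> divided by \<open>l\<close>.

  The transform is chosen to be nonpositive outside \<open>[-a, a]\<close>, with a negative part that is small
  compared to the positive part when \<open>a\<close> is large. Dropping the negative terms then bounds from
  below a sum over the short window \<open>\<bar>ln n - T\<bar> \<le> a / l\<close> (lemma \<open>local_mangoldt_sum_ge\<close>), and no a
  priori bound for \<open>\<psi>(x) = \<Sum>n\<le>x. \<Lambda>(n)\<close> is required. Averaging over \<open>T\<close> with weight \<open>exp T\<close> gives the
  lower bound for \<open>\<psi>\<close>, and \<open>\<psi> - \<theta>\<close> is negligible.
\<close>

section \<open>The von Mangoldt series and the zeta function\<close>

text \<open>
  The function \<open>n\<^sup>-\<^sup>s\<close>. Its value at \<open>n = 0\<close> is 0, so Dirichlet series can be summed over all natural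
  numbers.
\<close>

abbreviation npow :: "nat \<Rightarrow> complex \<Rightarrow> complex" where
  "npow n s \<equiv> of_nat n powr (- s)"

lemma norm_npow: "norm (npow n s) = real n powr (- Re s)"
  by (simp add: norm_powr_real_powr)

lemma npow_mult: "npow (m * n) s = npow m s * npow n s"
  by (simp add: powr_times_real)

lemma mangoldt_le_ln: "mangoldt n \<le> ln (real n)"
proof (cases "n = 0")
  case False
  have "(mangoldt n :: real) \<le> (\<Sum>d | d dvd n. mangoldt d)"
    using False by (intro member_le_sum) (auto simp: mangoldt_nonneg)
  with mangoldt_sum[of n] False show ?thesis by (simp add: mangoldt_sum)
qed simp

lemma summable_ln_powr:
  fixes \<sigma> :: real
  assumes "\<sigma> > 1"
  shows "summable (\<lambda>n. ln (real n) * real n powr (-\<sigma>))"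
proof (rule summable_comparison_test')
  define \<eta> where "\<eta> = (\<sigma> - 1) / 2"
  have \<eta>: "\<eta> > 0" using assms by (simp add: \<eta>_def)
  show "summable (\<lambda>n. real n powr (\<eta> - \<sigma>) / \<eta>)"
    using assms by (intro summable_divide) (simp add: summable_real_powr_iff \<eta>_def field_simps)
  show "norm (ln (real n) * real n powr (-\<sigma>)) \<le> real n powr (\<eta> - \<sigma>) / \<eta>" if "n \<ge> 1" for n
  proof -
    have "ln (real n) * real n powr (-\<sigma>) \<le> (real n powr \<eta> / \<eta>) * real n powr (-\<sigma>)"
      using ln_powr_bound[of "real n" \<eta>] \<eta> that by (intro mult_right_mono) auto
    also have "\<dots> = real n powr (\<eta> - \<sigma>) / \<eta>"
      by (simp add: powr_add[symmetric])
    finally show ?thesis using that by (simp add: abs_mult)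
  qed
qed

lemma summable_mangoldt_powr:
  fixes \<sigma> :: real
  assumes "\<sigma> > 1"
  shows "summable (\<lambda>n. mangoldt n * real n powr (-\<sigma>))"
  by (rule summable_comparison_test'[OF summable_ln_powr[OF assms], of 0])
     (auto intro!: mult_right_mono simp: mangoldt_le_ln abs_mult)

text \<open>
  The Riemann zeta function and the von Mangoldt series, as Dirichlet series. Both carry meaning
  only for real part greater than 1.
\<close>

definition zeta :: "complex \<Rightarrow> complex" where
  "zeta s = (\<Sum>n. npow n s)"

definition D_mangoldt :: "complex \<Rightarrow> complex" where
  "D_mangoldt s = (\<Sum>n. mangoldt n * npow n s)"

lemma summable_norm_npow:
  assumes "Re s > 1" shows "summable (\<lambda>n. norm (npow n s))"
  using assms by (simp add: norm_npow summable_real_powr_iff)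

lemma summable_norm_mangoldt_npow:
  assumes "Re s > 1" shows "summable (\<lambda>n. norm (mangoldt n * npow n s))"
  using summable_mangoldt_powr[OF assms] by (simp add: norm_mult norm_npow)

lemma zeta_has_field_derivative:
  assumes "Re s > 1"
  shows "(zeta has_field_derivative - (\<Sum>n. of_real (ln (real n)) * npow n s)) (at s)"
proof -
  define S where "S = {s::complex. Re s > 1}"
  have S: "open S" unfolding S_def by (rule open_halfspace_Re_gt)
  have "\<exists>g g'. \<forall>x\<in>S. (\<lambda>n. npow n x) sums g x \<and> (\<lambda>n. - of_real (ln (real n)) * npow n x) sums g' x
          \<and> (g has_field_derivative g' x) (at x)"
  proof (rule series_and_derivative_comparison_complex[OF S])
    fix n x assume "x \<in> S"
    show "((\<lambda>s. npow n s) has_field_derivative - of_real (ln (real n)) * npow n x) (at x)"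
    proof (cases "n = 0")
      case False
      then have "((\<lambda>s. exp (- s * of_real (ln (real n)))) has_field_derivative
          - of_real (ln (real n)) * npow n x) (at x)"
        by (auto intro!: derivative_eq_intros simp: powr_def Ln_of_nat)
      then show ?thesis using False by (simp add: powr_def Ln_of_nat)
    qed simp
  next
    fix x assume "x \<in> S"
    define d where "d = (Re x - 1) / 2"
    have d: "d > 0" "Re x - d > 1" using \<open>x \<in> S\<close> by (auto simp: d_def S_def field_simps)
    have "summable (\<lambda>n. real n powr (-(Re x - d)))"
      using d by (simp add: summable_real_powr_iff)
    then have "summable (\<lambda>n. complex_of_real (real n powr (-(Re x - d))))"
      by (simp only: summable_complex_of_real)
    moreover have "norm (npow n y) \<le> norm (complex_of_real (real n powr (-(Re x - d))))"
      if "y \<in> ball x d \<inter> S" for n y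
    proof (cases "n = 0")
      case False
      have "\<bar>Re (x - y)\<bar> < d"
        using that abs_Re_le_cmod[of "x - y"] by (auto simp: dist_norm)
      then have "- Re y \<le> -(Re x - d)" by simp
      then show ?thesis using False by (simp add: norm_npow powr_mono)
    qed simp
    ultimately show "\<exists>d h. 0 < d \<and> summable h \<and> range h \<subseteq> \<real>\<^sub>\<ge>\<^sub>0 \<and>
        (\<forall>\<^sub>F n in sequentially. \<forall>y\<in>ball x d \<inter> S. cmod (npow n y) \<le> cmod (h n))"
      using d by (intro exI[of _ d] exI[of _ "\<lambda>n. complex_of_real (real n powr (-(Re x - d)))"]) auto
  qed
  then obtain g g' where g: "\<And>x. x \<in> S \<Longrightarrow> (\<lambda>n. npow n x) sums g x"
      "\<And>x. x \<in> S \<Longrightarrow> (\<lambda>n. - of_real (ln (real n)) * npow n x) sums g' x"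
      "\<And>x. x \<in> S \<Longrightarrow> (g has_field_derivative g' x) (at x)" by blast
  have sS: "s \<in> S" using assms by (simp add: S_def)
  have "g' s = - (\<Sum>n. of_real (ln (real n)) * npow n s)"
    using sums_minus[OF g(2)[OF sS]] by (simp add: sums_iff)
  moreover have "\<And>x. x \<in> S \<Longrightarrow> g x = zeta x"
    using g(1) by (simp add: zeta_def sums_iff)
  ultimately show ?thesis
    using has_field_derivative_transform_within_open[OF g(3)[OF sS] S sS] by metis
qed

text \<open>
  The identity \<open>D_mangoldt = - zeta' / zeta\<close>, with the denominator cleared: it is the Dirichlet
  convolution \<open>\<Sum>d | d dvd n. \<Lambda>(d) = ln n\<close>.
\<close>

lemma mangoldt_times_zeta:
  assumes s: "Re s > 1"
  shows "D_mangoldt s * zeta s = - deriv zeta s"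
proof -
  have has_sum: "(f has_sum (\<Sum>n. f n)) {0<..}" if "f 0 = 0" "summable (\<lambda>n. norm (f n))" for f :: "nat \<Rightarrow> complex"
  proof -
    have "(f has_sum (\<Sum>n. f n)) UNIV"
      using that by (intro norm_summable_imp_has_sum) (auto simp: summable_norm_cancel summable_sums)
    moreover have "f n = 0" if "n \<in> UNIV - {0<..}" for n
      using that \<open>f 0 = 0\<close> by (cases n) auto
    ultimately show ?thesis
      using has_sum_cong_neutral[of "{0<..}" UNIV f f "\<Sum>n. f n"] by auto
  qed
  define a b where "a = (\<lambda>n. mangoldt n * npow n s)" and "b = (\<lambda>n. npow n s)"
  define F where "F = (\<lambda>(d, m). a d * b m)"
  have a: "(a has_sum D_mangoldt s) {0<..}" and b: "(b has_sum zeta s) {0<..}"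
    using has_sum[of a] has_sum[of b] summable_norm_npow[OF s] summable_norm_mangoldt_npow[OF s]
    by (auto simp: a_def b_def D_mangoldt_def zeta_def)
  have a': "(\<lambda>n. norm (a n)) summable_on {0<..}" and b': "(\<lambda>n. norm (b n)) summable_on {0<..}"
    using summable_norm_npow[OF s] summable_norm_mangoldt_npow[OF s]
    unfolding a_def b_def
    by (auto simp: summable_on_UNIV_nonneg_real_iff
             intro: summable_on_subset_banach[OF _ subset_UNIV])
  have "(\<lambda>x. norm (F x)) summable_on ({0<..} \<times> {0<..})"
  proof (rule summable_on_SigmaI)
    show "((\<lambda>m. norm (F (d, m))) has_sum norm (a d) * infsum (\<lambda>m. norm (b m)) {0<..}) {0<..}" for d
      unfolding F_def norm_mult prod.case using b' by (intro has_sum_cmult_right) simp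
    show "(\<lambda>d. norm (a d) * infsum (\<lambda>m. norm (b m)) {0<..}) summable_on {0<..}"
      using a' by (intro summable_on_cmult_left)
  qed auto
  then have F: "(F has_sum infsum F ({0<..} \<times> {0<..})) ({0<..} \<times> {0<..})"
    by (simp add: abs_summable_summable)
  define S where "S = infsum F ({0<..} \<times> {0<..})"
  have "((\<lambda>d. a d * zeta s) has_sum S) {0<..}"
    using F unfolding S_def by (rule has_sum_SigmaD) (auto simp: F_def intro!: has_sum_cmult_right b)
  then have 1: "S = D_mangoldt s * zeta s"
    using has_sum_cmult_left[OF a, of "zeta s"] by (rule has_sum_unique)
  \<comment> \<open>Pairs of factors are regrouped by their product: the pair (d, m) becomes (d m, d).\<close>
  define Q where "Q = Sigma {0<..} (\<lambda>n::nat. {d. d dvd n})"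
  have "bij_betw (\<lambda>(n, d). (d, n div d)) Q ({0<..} \<times> {0<..})"
    by (rule bij_betwI[where g = "\<lambda>(d, m). (d * m, d)"])
       (auto simp: Q_def dvd_div_eq_0_iff intro!: Nat.gr0I)
  from has_sum_reindex_bij_betw[OF this, of F S] F
  have "((\<lambda>x. F (case x of (n, d) \<Rightarrow> (d, n div d))) has_sum S) Q" by (simp add: S_def)
  moreover have "((\<lambda>d. F (case (n, d) of (n, d) \<Rightarrow> (d, n div d))) has_sum of_real (ln (real n)) * npow n s) {d. d dvd n}"
    if n: "n \<in> {0<..}" for n
  proof -
    have "F (d, n div d) = mangoldt d * npow n s" if "d dvd n" for d
      using that npow_mult[of d "n div d" s] by (simp add: F_def a_def b_def mult.assoc)
    then have "(\<Sum>d | d dvd n. F (d, n div d)) = (\<Sum>d | d dvd n. mangoldt d) * npow n s"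
      by (simp add: sum_distrib_right)
    also have "\<dots> = of_real (ln (real n)) * npow n s" using n by (simp add: mangoldt_sum)
    finally show ?thesis using n by (intro has_sum_finiteI) auto
  qed
  ultimately have 2: "((\<lambda>n. of_real (ln (real n)) * npow n s) has_sum S) {0<..}"
    unfolding Q_def by (rule has_sum_SigmaD)
  have "((\<lambda>n. of_real (ln (real n)) * npow n s) has_sum (\<Sum>n. of_real (ln (real n)) * npow n s)) {0<..}"
  proof (rule has_sum)
    have "summable (\<lambda>n. \<bar>ln (real n) * real n powr (-Re s)\<bar>)"
      using summable_ln_powr[OF s]
      by (rule summable_cong[THEN iffD1, rotated]) (auto simp: eventually_sequentially abs_mult intro!: exI[of _ 1])
    then show "summable (\<lambda>n. norm (of_real (ln (real n)) * npow n s))"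
      by (simp add: norm_mult norm_npow abs_mult)
  qed simp
  with 2 have "S = (\<Sum>n. of_real (ln (real n)) * npow n s)" by (rule has_sum_unique)
  with 1 show ?thesis using DERIV_imp_deriv[OF zeta_has_field_derivative[OF s]] by simp
qed

section \<open>Continuation and non-vanishing of zeta on the line of real part 1\<close>

text \<open>
  The continuation to \<open>Re s > 0\<close> of \<open>(s - 1) * zeta s\<close>. For \<open>Re s > 1\<close> the telescoping sum of the integrals of
  \<open>(s - 1) * x powr (- s)\<close> over unit intervals equals 1, and \<open>zetaC_term n s\<close> is the error made in
  replacing the integral over \<open>[n + 1, n + 2]\<close> by the value at its left endpoint.
\<close>

definition zetaC_term :: "nat \<Rightarrow> complex \<Rightarrow> complex" where
  "zetaC_term n s = (s - 1) * npow (Suc n) s - (npow (Suc n) (s - 1) - npow (Suc (Suc n)) (s - 1))"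

definition zetaC :: "complex \<Rightarrow> complex" where
  "zetaC s = 1 + (\<Sum>n. zetaC_term n s)"

lemma norm_zetaC_term_le:
  assumes s: "Re s > 0"
  shows "norm (zetaC_term n s) \<le> norm (s - 1) * norm s * real (Suc n) powr (- Re s - 1)"
proof -
  define w z :: complex where "w = of_nat (Suc n)" and "z = of_nat (Suc (Suc n))"
  define S where "S = closed_segment w z"
  define f :: "nat \<Rightarrow> complex \<Rightarrow> complex" where
    "f = (\<lambda>i x. if i = 0 then x powr (1 - s) else if i = 1 then (1 - s) * x powr (- s)
                else (1 - s) * (- s) * x powr (- s - 1))"
  define B where "B = norm (s - 1) * norm s * real (Suc n) powr (- Re s - 1)"
  have S: "\<exists>t. x = of_real t \<and> real (Suc n) \<le> t" if "x \<in> S" for x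
  proof -
    from that obtain u where u: "0 \<le> u" "u \<le> 1" "x = (1 - u) *\<^sub>R w + u *\<^sub>R z"
      by (auto simp: S_def closed_segment_def)
    have "(1 - u) *\<^sub>R w + u *\<^sub>R z = w + u *\<^sub>R (z - w)"
      by (simp add: scaleR_left_diff_distrib scaleR_right_diff_distrib)
    also have "z - w = 1" by (simp add: w_def z_def)
    finally have "x = of_real (real (Suc n) + u)"
      using u(3) by (simp add: w_def scaleR_conv_of_real)
    with u(1) show ?thesis by (intro exI[of _ "real (Suc n) + u"]) auto
  qed
  have nonneg: "x \<notin> \<real>\<^sub>\<le>\<^sub>0" if x: "x \<in> S" for x
  proof -
    from S[OF x] obtain t where "x = of_real t" "real (Suc n) \<le> t" by blast
    then show ?thesis by (simp add: complex_nonpos_Reals_iff)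
  qed
  \<comment> \<open>The term is a first-order Taylor remainder of the power function between consecutive integers.\<close>
  have "norm (f 0 z - (\<Sum>i\<le>1. f i w * (z - w) ^ i / fact i)) \<le> B * norm (z - w) ^ Suc 1 / fact 1"
  proof (rule field_Taylor[where S = S and f = f and n = 1 and B = B and w = w and z = z])
    show "convex S" by (simp add: S_def)
    show "w \<in> S" "z \<in> S" by (simp_all add: S_def)
    show "(f i has_field_derivative f (Suc i) x) (at x within S)" if "x \<in> S" "i \<le> 1" for i x
    proof -
      have d0: "((\<lambda>x. x powr (1 - s)) has_field_derivative (1 - s) * x powr (1 - s - 1)) (at x within S)"
        by (rule has_field_derivative_at_within[OF has_field_derivative_powr[OF nonneg[OF that(1)]]])
      have d1: "((\<lambda>x. (1 - s) * x powr (- s)) has_field_derivative (1 - s) * (- s * x powr (- s - 1))) (at x within S)"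
        by (rule DERIV_cmult[OF has_field_derivative_at_within[OF has_field_derivative_powr[OF nonneg[OF that(1)]]]])
      from that(2) consider "i = 0" | "i = 1" by linarith
      then show ?thesis
      proof cases
        case 1
        then show ?thesis using d0 by (simp add: f_def)
      next
        case 2
        then show ?thesis using d1 by (simp add: f_def mult.assoc)
      qed
    qed
    show "norm (f (Suc 1) x) \<le> B" if x: "x \<in> S" for x
    proof -
      from S[OF x] obtain t where t: "x = of_real t" "real (Suc n) \<le> t" by auto
      have "norm (x powr (- s - 1)) = t powr (- Re s - 1)"
        using t by (simp add: norm_powr_real_powr)
      also have "\<dots> \<le> real (Suc n) powr (- Re s - 1)"
        using t s by (intro powr_mono2') auto
      finally show ?thesis
        by (simp add: f_def B_def norm_mult norm_minus_commute[of 1 s] mult_left_mono)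
    qed
  qed
  moreover have "z - w = 1" by (simp add: z_def w_def)
  moreover have "zetaC_term n s = f 0 z - (f 0 w + f 1 w)"
    by (simp add: zetaC_term_def f_def w_def z_def algebra_simps)
  ultimately show ?thesis by (simp add: B_def)
qed

lemma zetaC_term_sums:
  obtains g where "\<And>s. Re s > 0 \<Longrightarrow> (\<lambda>n. zetaC_term n s) sums g s"
    "\<And>s. Re s > 0 \<Longrightarrow> g field_differentiable (at s)"
proof -
  define S where "S = {s::complex. Re s > 0}"
  have S: "open S" unfolding S_def by (rule open_halfspace_Re_gt)
  obtain g where "\<forall>s\<in>S. (\<lambda>n. zetaC_term n s) sums g s \<and> g field_differentiable (at s)"
  proof (rule series_differentiable_comparison_complex[OF S])
    show "zetaC_term n field_differentiable (at x)" for n x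
    proof -
      have "zetaC_term n holomorphic_on UNIV"
        unfolding zetaC_term_def[abs_def] by (intro holomorphic_intros)
      then show ?thesis by (rule holomorphic_on_imp_differentiable_at) auto
    qed
  next
    fix x assume "x \<in> S"
    define d where "d = Re x / 2"
    have d: "d > 0" using \<open>x \<in> S\<close> by (auto simp: d_def S_def)
    define C where "C = (norm x + d + 1) * (norm x + d)"
    define h where "h = (\<lambda>n. C * real (Suc n) powr (- d - 1))"
    have C: "C \<ge> 0" using d by (simp add: C_def)
    have "summable (\<lambda>n. real n powr (- d - 1))"
      using d by (simp add: summable_real_powr_iff)
    then have "summable h" unfolding h_def
      by (intro summable_mult) (subst summable_Suc_iff)
    then have "summable (\<lambda>n. complex_of_real (h n))"
      by (simp only: summable_complex_of_real)
    moreover have "norm (zetaC_term n y) \<le> norm (complex_of_real (h n))"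
      if y: "y \<in> ball x d \<inter> S" for n y
    proof -
      have xy: "norm (x - y) < d" using y by (auto simp: dist_norm)
      have "\<bar>Re (x - y)\<bar> < d"
        using xy abs_Re_le_cmod[of "x - y"] by linarith
      then have "Re x - Re y < d" by simp
      then have "Re y > d" by (simp add: d_def)
      have ny: "norm y \<le> norm x + d"
        using xy norm_triangle_ineq2[of y x] by (simp add: norm_minus_commute)
      then have ny': "norm (y - 1) \<le> norm x + d + 1"
        using norm_triangle_ineq4[of y 1] by simp
      have "norm (zetaC_term n y) \<le> norm (y - 1) * norm y * real (Suc n) powr (- Re y - 1)"
        using \<open>Re y > d\<close> d by (intro norm_zetaC_term_le) auto
      also have "\<dots> \<le> C * real (Suc n) powr (- d - 1)"
        unfolding C_def using ny ny' d \<open>Re y > d\<close> by (intro mult_mono powr_mono) auto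
      also have "\<dots> = norm (complex_of_real (h n))"
        using C by (simp only: norm_of_real) (simp add: h_def abs_mult)
      finally show ?thesis .
    qed
    ultimately show "\<exists>d h. 0 < d \<and> summable h \<and> range h \<subseteq> \<real>\<^sub>\<ge>\<^sub>0 \<and>
        (\<forall>\<^sub>F n in sequentially. \<forall>y\<in>ball x d \<inter> S. cmod (zetaC_term n y) \<le> cmod (h n))"
      using d C by (intro exI[of _ d] exI[of _ "\<lambda>n. complex_of_real (h n)"]) (auto simp: h_def)
  qed
  then show ?thesis using that[of g] by (auto simp: S_def)
qed

lemma zetaC_holomorphic: "zetaC holomorphic_on {s. Re s > 0}"
proof -
  obtain g where g: "\<And>s. Re s > 0 \<Longrightarrow> (\<lambda>n. zetaC_term n s) sums g s"
    "\<And>s. Re s > 0 \<Longrightarrow> g field_differentiable (at s)" by (rule zetaC_term_sums) auto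
  have "g holomorphic_on {s. Re s > 0}"
    unfolding holomorphic_on_def
  proof
    fix s assume "s \<in> {s::complex. Re s > 0}"
    then show "g field_differentiable (at s within {s. Re s > 0})"
      using field_differentiable_at_within[OF g(2)[of s]] by simp
  qed
  then have "(\<lambda>s. 1 + g s) holomorphic_on {s. Re s > 0}"
    by (intro holomorphic_intros)
  moreover have "1 + g s = zetaC s" if "s \<in> {s. Re s > 0}" for s
  proof -
    have "(\<Sum>n. zetaC_term n s) = g s" using g(1)[of s] that by (intro sums_unique[symmetric]) simp
    then show ?thesis by (simp add: zetaC_def)
  qed
  ultimately show ?thesis by (rule holomorphic_transform)
qed

lemma zetaC_1: "zetaC 1 = 1"
proof -
  have "complex_of_nat (Suc n) \<noteq> 0" for n by (rule of_nat_neq_0)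
  then have "zetaC_term n 1 = 0" for n by (simp add: zetaC_term_def del: of_nat_Suc)
  then show ?thesis by (simp add: zetaC_def)
qed

lemma zetaC_eq:
  assumes s: "Re s > 1"
  shows "zetaC s = (s - 1) * zeta s"
proof -
  have "(\<lambda>n. npow n s) sums zeta s"
    unfolding zeta_def by (rule summable_sums[OF summable_norm_cancel[OF summable_norm_npow[OF s]]])
  then have "(\<lambda>n. npow (Suc n) s) sums zeta s"
    using sums_Suc_iff[of "\<lambda>n. npow n s" "zeta s"] by (simp del: of_nat_Suc)
  then have 1: "(\<lambda>n. (s - 1) * npow (Suc n) s) sums ((s - 1) * zeta s)"
    by (rule sums_mult)
  have "(\<lambda>n. npow (Suc n) (s - 1)) \<longlonglongrightarrow> 0"
    by (rule tendsto_neg_powr_complex_of_nat[OF filterlim_Suc]) (use s in simp)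
  then have "(\<lambda>n. npow (Suc n) (s - 1) - npow (Suc (Suc n)) (s - 1)) sums (npow (Suc 0) (s - 1) - 0)"
    by (rule telescope_sums')
  moreover have "npow (Suc 0) (s - 1) - 0 = 1" by simp
  ultimately have 2: "(\<lambda>n. npow (Suc n) (s - 1) - npow (Suc (Suc n)) (s - 1)) sums 1" by metis
  have "(\<Sum>n. zetaC_term n s) = (s - 1) * zeta s - 1"
    unfolding zetaC_term_def by (rule sums_unique[symmetric, OF sums_diff[OF 1 2]])
  then show ?thesis by (simp add: zetaC_def)
qed

text \<open>
  The negative logarithmic derivative of \<^term>\<open>zetaC\<close>. For \<open>Re s > 1\<close> it is the von Mangoldt series
  minus its polar part \<open>1 / (s - 1)\<close>.
\<close>

definition H_zeta :: "complex \<Rightarrow> complex" where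
  "H_zeta s = - deriv zetaC s / zetaC s"

lemma D_mangoldt_zetaC:
  assumes s: "Re s > 1"
  shows "D_mangoldt s * zetaC s = - deriv zetaC s + zetaC s / (s - 1)"
proof -
  have "((\<lambda>s. (s - 1) * zeta s) has_field_derivative zeta s + (s - 1) * deriv zeta s) (at s)"
  proof -
    have "(zeta has_field_derivative deriv zeta s) (at s)"
      using zeta_has_field_derivative[OF s] DERIV_imp_deriv by metis
    then show ?thesis by (auto intro!: derivative_eq_intros)
  qed
  moreover have "open {s. Re s > 1}" by (rule open_halfspace_Re_gt)
  ultimately have "(zetaC has_field_derivative zeta s + (s - 1) * deriv zeta s) (at s)"
    by (rule has_field_derivative_transform_within_open) (use s in \<open>auto simp: zetaC_eq\<close>)
  then have d: "deriv zetaC s = zeta s + (s - 1) * deriv zeta s" by (rule DERIV_imp_deriv)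
  have "D_mangoldt s * zetaC s = (s - 1) * (D_mangoldt s * zeta s)"
    by (simp add: zetaC_eq[OF s])
  also have "\<dots> = - ((s - 1) * deriv zeta s)" by (simp add: mangoldt_times_zeta[OF s])
  also have "\<dots> = - deriv zetaC s + zeta s" by (simp add: d)
  also have "zeta s = zetaC s / (s - 1)" using s by (auto simp: zetaC_eq)
  finally show ?thesis .
qed

lemma D_mangoldt_eq_H_zeta:
  assumes s: "Re s > 1" and nz: "zetaC s \<noteq> 0"
  shows "D_mangoldt s = H_zeta s + 1 / (s - 1)"
proof -
  have "D_mangoldt s = (- deriv zetaC s + zetaC s / (s - 1)) / zetaC s"
    using D_mangoldt_zetaC[OF s] nz by (metis nonzero_mult_div_cancel_right)
  also have "\<dots> = H_zeta s + 1 / (s - 1)"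
    using nz by (simp add: H_zeta_def add_divide_distrib diff_divide_distrib)
  finally show ?thesis .
qed

text \<open>
  The logarithmic derivative has a simple pole at a zero, with residue the order \<open>m\<close>; the case
  \<open>m = 0\<close> is that of a point where the function does not vanish.
\<close>

lemma log_deriv_order:
  fixes f :: "complex \<Rightarrow> complex"
  assumes f: "f holomorphic_on S" "open S" "connected S" and z0: "z0 \<in> S" and z1: "z1 \<in> S" "f z1 \<noteq> 0"
  obtains m :: nat where "f z0 = 0 \<Longrightarrow> m > 0" 
    "((\<lambda>z. (z - z0) * (deriv f z / f z)) \<longlongrightarrow> of_nat m) (at z0)"
    "eventually (\<lambda>z. f z \<noteq> 0) (at z0)"
proof (cases "f z0 = 0")
  case True
  have "\<not> f constant_on S" using True z0 z1 unfolding constant_on_def by metis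
  then obtain g r m where g: "0 < m" "0 < r" "ball z0 r \<subseteq> S" "g holomorphic_on ball z0 r"
      "\<And>w. w \<in> ball z0 r \<Longrightarrow> f w = (w - z0) ^ m * g w" "\<And>w. w \<in> ball z0 r \<Longrightarrow> g w \<noteq> 0"
    using holomorphic_factor_zero_nonconstant[OF f z0 True] by metis
  have ev: "eventually (\<lambda>z. z \<in> ball z0 r - {z0}) (at z0)"
    using g(2) by (intro eventually_at_in_open) auto
  have eq: "(z - z0) * (deriv f z / f z) = of_nat m + (z - z0) * (deriv g z / g z)"
    if z: "z \<in> ball z0 r - {z0}" for z
  proof -
    have "(g has_field_derivative deriv g z) (at z)"
      using g(4) z by (intro holomorphic_derivI[of g "ball z0 r"]) auto
    then have "((\<lambda>w. (w - z0) ^ m * g w) has_field_derivative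
        of_nat m * (z - z0) ^ (m - 1) * g z + (z - z0) ^ m * deriv g z) (at z)"
      by (auto intro!: derivative_eq_intros)
    then have "(f has_field_derivative
        of_nat m * (z - z0) ^ (m - 1) * g z + (z - z0) ^ m * deriv g z) (at z)"
      by (rule has_field_derivative_transform_within_open[where S = "ball z0 r"]) (use z g in auto)
    then have "deriv f z = of_nat m * (z - z0) ^ (m - 1) * g z + (z - z0) ^ m * deriv g z"
      by (rule DERIV_imp_deriv)
    moreover have "(z - z0) * (of_nat m * (z - z0) ^ (m - 1) * g z) = of_nat m * f z"
      using g(1) g(5)[of z] z by (cases m) auto
    moreover have "(z - z0) ^ m * deriv g z = f z * (deriv g z / g z)"
      using g(5)[of z] g(6)[of z] z by simp
    moreover have "f z \<noteq> 0" using g(5)[of z] g(6)[of z] z by auto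
    ultimately have "(z - z0) * deriv f z = of_nat m * f z + (z - z0) * (f z * (deriv g z / g z))"
      by (simp only: distrib_left)
    then have "(z - z0) * deriv f z / f z = of_nat m + (z - z0) * (deriv g z / g z)"
      using \<open>f z \<noteq> 0\<close> by (simp add: add_divide_distrib)
    then show ?thesis by simp
  qed
  have "((\<lambda>z. of_nat m + (z - z0) * (deriv g z / g z)) \<longlongrightarrow> of_nat m + (z0 - z0) * (deriv g z0 / g z0)) (at z0)"
  proof -
    have "isCont g z0" "isCont (deriv g) z0"
      using g(2,4) by (auto intro!: holomorphic_on_imp_continuous_on holomorphic_deriv
          continuous_on_interior[of "ball z0 r"] simp: interior_open)
    then show ?thesis using g(6)[of z0] g(2) by (intro tendsto_intros) (auto simp: isCont_def)
  qed
  then have "((\<lambda>z. (z - z0) * (deriv f z / f z)) \<longlongrightarrow> of_nat m) (at z0)"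
    using eq by (subst tendsto_cong[OF eventually_mono[OF ev]]) auto
  moreover have "eventually (\<lambda>z. f z \<noteq> 0) (at z0)"
    using ev by eventually_elim (use g in auto)
  ultimately show ?thesis using that g(1) by blast
next
  case False
  have c: "isCont f z0" "isCont (deriv f) z0"
    using f z0 by (auto intro!: holomorphic_on_imp_continuous_on holomorphic_deriv
          continuous_on_interior[of S] simp: interior_open)
  then have "((\<lambda>z. (z - z0) * (deriv f z / f z)) \<longlongrightarrow> (z0 - z0) * (deriv f z0 / f z0)) (at z0)"
    using False by (intro tendsto_intros) (auto simp: isCont_def)
  moreover have "eventually (\<lambda>z. f z \<noteq> 0) (at z0)"
    using c(1) False unfolding isCont_def by (rule tendsto_imp_eventually_ne)
  ultimately show ?thesis using that[of 0] False by simp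
qed

lemma D_mangoldt_sums:
  assumes "Re s > 1" shows "(\<lambda>n. mangoldt n * npow n s) sums D_mangoldt s"
  unfolding D_mangoldt_def
  by (rule summable_sums[OF summable_norm_cancel[OF summable_norm_mangoldt_npow[OF assms]]])

lemma norm_D_mangoldt_le:
  assumes "\<sigma> > 1" "Re s \<ge> \<sigma>"
  shows "norm (D_mangoldt s) \<le> (\<Sum>n. mangoldt n * real n powr (-\<sigma>))"
proof -
  have s: "Re s > 1" using assms by simp
  have "norm (D_mangoldt s) \<le> (\<Sum>n. norm (mangoldt n * npow n s))"
    unfolding D_mangoldt_def using summable_norm_mangoldt_npow[OF s] by (rule summable_norm)
  also have "\<dots> \<le> (\<Sum>n. mangoldt n * real n powr (-\<sigma>))"
  proof (rule suminf_le)
    show "norm (mangoldt n * npow n s) \<le> mangoldt n * real n powr (-\<sigma>)" for n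
      using assms by (cases "n = 0") (auto simp: norm_mult norm_npow mangoldt_nonneg intro!: mult_left_mono powr_mono)
  qed (use assms summable_mangoldt_powr summable_norm_mangoldt_npow[OF s] in auto)
  finally show ?thesis .
qed

text \<open>
  Approaching \<open>s0\<close> horizontally from the right, the von Mangoldt series detects the order of
  vanishing of \<^term>\<open>zetaC\<close> at \<open>s0\<close>.
\<close>

lemma D_mangoldt_order:
  assumes s0: "Re s0 \<ge> 1"
  obtains m :: nat where "zetaC s0 = 0 \<Longrightarrow> m > 0"
    "((\<lambda>\<epsilon>. of_real \<epsilon> * (D_mangoldt (s0 + of_real \<epsilon>) - 1 / (s0 + of_real \<epsilon> - 1))) \<longlongrightarrow> - of_nat m) (at_right 0)"
proof -
  define S where "S = {s::complex. Re s > 0}"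
  have S: "open S" "connected S" unfolding S_def
    by (auto intro: open_halfspace_Re_gt convex_connected convex_halfspace_Re_gt)
  obtain m :: nat where m: "zetaC s0 = 0 \<Longrightarrow> m > 0" 
    "((\<lambda>z. (z - s0) * (deriv zetaC z / zetaC z)) \<longlongrightarrow> of_nat m) (at s0)"
    "eventually (\<lambda>z. zetaC z \<noteq> 0) (at s0)"
    by (rule log_deriv_order[of zetaC S s0 1])
       (use zetaC_holomorphic S s0 in \<open>auto simp: S_def zetaC_1\<close>)
  have lim: "filterlim (\<lambda>\<epsilon>. s0 + of_real \<epsilon>) (at s0) (at_right (0::real))"
    by (auto simp: filterlim_at eventually_at_filter intro!: tendsto_eq_intros)
  have "((\<lambda>\<epsilon>. - ((s0 + of_real \<epsilon> - s0) * (deriv zetaC (s0 + of_real \<epsilon>) / zetaC (s0 + of_real \<epsilon>)))) \<longlongrightarrow> - of_nat m) (at_right (0::real))"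
    by (intro tendsto_minus filterlim_compose[OF m(2) lim])
  moreover have "eventually (\<lambda>\<epsilon>::real. zetaC (s0 + of_real \<epsilon>) \<noteq> 0) (at_right 0)"
    using m(3) lim by (rule eventually_compose_filterlim)
  moreover have "eventually (\<lambda>\<epsilon>::real. \<epsilon> > 0) (at_right 0)"
    by (simp add: eventually_at_filter)
  then have "eventually (\<lambda>\<epsilon>::real. - ((s0 + of_real \<epsilon> - s0) * (deriv zetaC (s0 + of_real \<epsilon>) / zetaC (s0 + of_real \<epsilon>))) =
      of_real \<epsilon> * (D_mangoldt (s0 + of_real \<epsilon>) - 1 / (s0 + of_real \<epsilon> - 1))) (at_right 0)"
    using calculation(2)
  proof eventually_elim
    case (elim \<epsilon>)
    then show ?case using D_mangoldt_eq_H_zeta[of "s0 + of_real \<epsilon>"] s0 by (simp add: H_zeta_def)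
  qed
  ultimately have "((\<lambda>\<epsilon>. of_real \<epsilon> * (D_mangoldt (s0 + of_real \<epsilon>) - 1 / (s0 + of_real \<epsilon> - 1))) \<longlongrightarrow> - of_nat m) (at_right 0)"
    by (blast intro: Lim_transform_eventually)
  with m(1) show ?thesis by (rule that)
qed

lemma D_mangoldt_order':
  assumes s0: "Re s0 \<ge> 1" "s0 \<noteq> 1"
  obtains m :: nat where "zetaC s0 = 0 \<Longrightarrow> m > 0"
    "((\<lambda>\<epsilon>. of_real \<epsilon> * D_mangoldt (s0 + of_real \<epsilon>)) \<longlongrightarrow> - of_nat m) (at_right 0)"
proof -
  obtain m :: nat where m: "zetaC s0 = 0 \<Longrightarrow> m > 0"
    "((\<lambda>\<epsilon>. of_real \<epsilon> * (D_mangoldt (s0 + of_real \<epsilon>) - 1 / (s0 + of_real \<epsilon> - 1))) \<longlongrightarrow> - of_nat m) (at_right 0)"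
    using D_mangoldt_order[OF s0(1)] by blast
  have "((\<lambda>\<epsilon>. of_real \<epsilon> / (s0 + of_real \<epsilon> - 1)) \<longlongrightarrow> of_real 0 / (s0 + of_real 0 - 1)) (at_right 0)"
    using s0 by (intro tendsto_intros) auto
  from tendsto_add[OF m(2) this] have
    "((\<lambda>\<epsilon>. of_real \<epsilon> * D_mangoldt (s0 + of_real \<epsilon>)) \<longlongrightarrow> - of_nat m) (at_right 0)"
    by (simp add: algebra_simps)
  with m(1) show ?thesis by (rule that)
qed

lemma zetaC_nonzero_gt_1:
  assumes "Re s > 1" shows "zetaC s \<noteq> 0"
proof -
  obtain m :: nat where m: "zetaC s = 0 \<Longrightarrow> m > 0"
    "((\<lambda>\<epsilon>. of_real \<epsilon> * D_mangoldt (s + of_real \<epsilon>)) \<longlongrightarrow> - of_nat m) (at_right 0)"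
    using D_mangoldt_order'[of s] assms by (metis less_eq_real_def one_complex.simps(1) order_less_irrefl)
  have "((\<lambda>\<epsilon>. of_real \<epsilon> * D_mangoldt (s + of_real \<epsilon>)) \<longlongrightarrow> 0) (at_right 0)"
  proof (rule Lim_null_comparison)
    define C where "C = (\<Sum>n. mangoldt n * real n powr (-Re s))"
    show "((\<lambda>\<epsilon>. \<epsilon> * C) \<longlongrightarrow> 0) (at_right (0::real))"
      by (auto intro!: tendsto_eq_intros)
    have "eventually (\<lambda>\<epsilon>::real. \<epsilon> > 0) (at_right 0)" by (simp add: eventually_at_filter)
    then show "\<forall>\<^sub>F \<epsilon> in at_right 0. norm (of_real \<epsilon> * D_mangoldt (s + of_real \<epsilon>)) \<le> \<epsilon> * C"
    proof eventually_elim
      case (elim \<epsilon>)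
      then show ?case using norm_D_mangoldt_le[of "Re s" "s + of_real \<epsilon>"] assms
        by (simp add: norm_mult C_def)
    qed
  qed
  with m(2) have "- of_nat m = (0::complex)" by (intro tendsto_unique[of "at_right (0::real)"]) auto
  with m(1) show ?thesis by auto
qed

text \<open>
  Mertens's inequality: termwise, it is \<open>3 + 4 cos x + cos (2 x) = 2 (1 + cos x)\<^sup>2 \<ge> 0\<close>.
\<close>

lemma Re_D_mangoldt_3_4_1:
  fixes t :: real
  assumes "\<epsilon> > 0"
  shows "Re (3 * D_mangoldt (1 + of_real \<epsilon>) + 4 * D_mangoldt (1 + \<i> * t + of_real \<epsilon>) + D_mangoldt (1 + \<i> * (2 * t) + of_real \<epsilon>)) \<ge> 0"
proof -
  define s where "s = (\<lambda>u::real. 1 + \<i> * of_real u + of_real \<epsilon>)"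
  have sums: "(\<lambda>n. Re (mangoldt n * npow n (s u))) sums Re (D_mangoldt (s u))" for u
    using assms by (intro sums_Re D_mangoldt_sums) (simp add: s_def)
  have "(\<lambda>n. 3 * Re (mangoldt n * npow n (s 0)) + 4 * Re (mangoldt n * npow n (s t)) + Re (mangoldt n * npow n (s (2 * t))))
      sums (3 * Re (D_mangoldt (s 0)) + 4 * Re (D_mangoldt (s t)) + Re (D_mangoldt (s (2*t))))"
    by (intro sums_add sums_mult sums)
  moreover have "0 \<le> 3 * Re (mangoldt n * npow n (s 0)) + 4 * Re (mangoldt n * npow n (s t)) + Re (mangoldt n * npow n (s (2 * t)))" for n
  proof (cases "n = 0")
    case False
    define x where "x = t * ln (real n)"
    have re: "Re (mangoldt n * npow n (s u)) = mangoldt n * (real n powr (- 1 - \<epsilon>) * cos (u * ln (real n)))" for u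
      using False by (simp add: s_def powr_def Re_exp Ln_of_nat powr_def algebra_simps)
    have "0 \<le> 2 * (1 + cos x)\<^sup>2" by simp
    also have "\<dots> = 3 + 4 * cos x + cos (2 * x)"
      unfolding cos_double_cos by (simp add: power2_eq_square algebra_simps)
    finally have "0 \<le> (mangoldt n * real n powr (- 1 - \<epsilon>)) * (3 + 4 * cos x + cos (2 * x))"
      by (intro mult_nonneg_nonneg mangoldt_nonneg) auto
    then show ?thesis unfolding re by (simp add: x_def algebra_simps)
  qed simp
  ultimately have "0 \<le> 3 * Re (D_mangoldt (s 0)) + 4 * Re (D_mangoldt (s t)) + Re (D_mangoldt (s (2*t)))"
    by (metis (no_types, lifting) sums_le sums_zero)
  then show ?thesis by (simp add: s_def)
qed

text \<open>
  A zero of order \<open>m > 0\<close> at \<open>1 + \<i> t\<close> would give \<open>3 - 4 m - n \<ge> 0\<close> for the order \<open>n \<ge> 0\<close> of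
  vanishing at \<open>1 + 2 \<i> t\<close>.
\<close>

lemma zetaC_nonzero:
  assumes "Re s \<ge> 1" shows "zetaC s \<noteq> 0"
proof (cases "Re s > 1 \<or> s = 1")
  case True
  then show ?thesis using zetaC_nonzero_gt_1 zetaC_1 by auto
next
  case False
  define t where "t = Im s"
  have s: "s = 1 + \<i> * t" and t: "t \<noteq> 0"
    using False assms by (auto simp: t_def complex_eq_iff)
  obtain m :: nat where m: "zetaC s = 0 \<Longrightarrow> m > 0"
    "((\<lambda>\<epsilon>. of_real \<epsilon> * D_mangoldt (s + of_real \<epsilon>)) \<longlongrightarrow> - of_nat m) (at_right 0)"
    using D_mangoldt_order'[of s] assms False by blast
  obtain n :: nat where n:
    "((\<lambda>\<epsilon>. of_real \<epsilon> * D_mangoldt (1 + \<i> * (2 * t) + of_real \<epsilon>)) \<longlongrightarrow> - of_nat n) (at_right 0)"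
    using D_mangoldt_order'[of "1 + \<i> * (2 * t)"] t by auto
  obtain l :: nat where
    "((\<lambda>\<epsilon>. of_real \<epsilon> * (D_mangoldt (1 + of_real \<epsilon>) - 1 / (1 + of_real \<epsilon> - 1))) \<longlongrightarrow> - of_nat l) (at_right 0)"
    using D_mangoldt_order[of 1] by auto
  moreover have "((\<lambda>\<epsilon>::real. of_real \<epsilon> * (1 / (1 + of_real \<epsilon> - 1))) \<longlongrightarrow> (1::complex)) (at_right 0)"
    by (rule tendsto_eventually) (auto simp: eventually_at_filter)
  ultimately have "((\<lambda>\<epsilon>. of_real \<epsilon> * (D_mangoldt (1 + of_real \<epsilon>) - 1 / (1 + of_real \<epsilon> - 1)) + of_real \<epsilon> * (1 / (1 + of_real \<epsilon> - 1)))
      \<longlongrightarrow> - of_nat l + 1) (at_right 0)" by (rule tendsto_add)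
  then have l: "((\<lambda>\<epsilon>. of_real \<epsilon> * D_mangoldt (1 + of_real \<epsilon>)) \<longlongrightarrow> - of_nat l + 1) (at_right 0)"
    by (simp only: ring_distribs(1)[symmetric] diff_add_cancel)
  have "((\<lambda>\<epsilon>. Re (3 * (of_real \<epsilon> * D_mangoldt (1 + of_real \<epsilon>)) + 4 * (of_real \<epsilon> * D_mangoldt (s + of_real \<epsilon>))
        + of_real \<epsilon> * D_mangoldt (1 + \<i> * (2 * t) + of_real \<epsilon>)))
      \<longlongrightarrow> Re (3 * (- of_nat l + 1) + 4 * (- of_nat m) + - of_nat n)) (at_right 0)"
    by (intro tendsto_intros l m n)
  moreover have "eventually (\<lambda>\<epsilon>::real. \<epsilon> > 0) (at_right 0)" by (simp add: eventually_at_filter)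
  then have "eventually (\<lambda>\<epsilon>. 0 \<le> Re (3 * (of_real \<epsilon> * D_mangoldt (1 + of_real \<epsilon>)) + 4 * (of_real \<epsilon> * D_mangoldt (s + of_real \<epsilon>))
        + of_real \<epsilon> * D_mangoldt (1 + \<i> * (2 * t) + of_real \<epsilon>))) (at_right 0)"
  proof eventually_elim
    case (elim \<epsilon>)
    have "0 \<le> \<epsilon> * Re (3 * D_mangoldt (1 + of_real \<epsilon>) + 4 * D_mangoldt (s + of_real \<epsilon>) + D_mangoldt (1 + \<i> * (2 * t) + of_real \<epsilon>))"
      unfolding s using elim by (intro mult_nonneg_nonneg Re_D_mangoldt_3_4_1) auto
    then show ?case by (simp add: algebra_simps)
  qed
  ultimately have "0 \<le> Re (3 * (- of_nat l + 1) + 4 * (- of_nat m) + - of_nat n)"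
    by (rule tendsto_lowerbound) simp
  then have "m = 0" by simp
  with m(1) show ?thesis by auto
qed

lemma H_zeta_holomorphic:
  "H_zeta holomorphic_on {s. Re s > 0 \<and> zetaC s \<noteq> 0}" "open {s. Re s > 0 \<and> zetaC s \<noteq> 0}"
proof -
  have o: "open {s::complex. Re s > 0}" by (rule open_halfspace_Re_gt)
  have "open ({s. Re s > 0} \<inter> zetaC -` (- {0}))"
    by (rule continuous_open_preimage[OF holomorphic_on_imp_continuous_on[OF zetaC_holomorphic] o]) auto
  also have "{s. Re s > 0} \<inter> zetaC -` (- {0}) = {s. Re s > 0 \<and> zetaC s \<noteq> 0}" by auto
  finally show "open {s. Re s > 0 \<and> zetaC s \<noteq> 0}" .
  show "H_zeta holomorphic_on {s. Re s > 0 \<and> zetaC s \<noteq> 0}"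
    unfolding H_zeta_def
    by (intro holomorphic_intros holomorphic_on_subset[OF holomorphic_deriv[OF zetaC_holomorphic o]]
          holomorphic_on_subset[OF zetaC_holomorphic]) auto
qed

section \<open>A band-limited kernel that is positive only on an interval\<close>

text \<open>
  Write \<open>k y = (1 - y) cos (\<pi> y) + sin (\<pi> y) / \<pi>\<close>. Its cosine transform over \<open>[0, 1]\<close> is
  \<open>2 \<pi>\<^sup>2 (1 + cos u) / (\<pi>\<^sup>2 - u\<^sup>2)\<^sup>2\<close>, which is nonnegative and decays like \<open>u\<close> to the power -4. The
  kernel \<open>kern a\<close> is \<open>k + k'' / a\<^sup>2\<close>, which multiplies the transform by \<open>1 - u\<^sup>2 / a\<^sup>2\<close>, so that
  its sign changes exactly at \<open>\<bar>u\<bar> = a\<close>. The function \<open>kern' a\<close> is its derivative.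
\<close>

definition kern :: "real \<Rightarrow> real \<Rightarrow> real" where
  "kern a y = (1 - pi\<^sup>2 / a\<^sup>2) * (1 - y) * cos (pi * y) + (1 + pi\<^sup>2 / a\<^sup>2) * sin (pi * y) / pi"

definition kern' :: "real \<Rightarrow> real \<Rightarrow> real" where
  "kern' a y = 2 * (pi\<^sup>2 / a\<^sup>2) * cos (pi * y) - pi * (1 - pi\<^sup>2 / a\<^sup>2) * (1 - y) * sin (pi * y)"

text \<open>
  The cosine transform of the kernel, and its positive part. The latter is supported on \<open>[-a, a]\<close>
  as soon as \<open>a \<ge> 2 \<pi>\<close>.
\<close>

definition kern_hat :: "real \<Rightarrow> real \<Rightarrow> real" where
  "kern_hat a u = integral {0..1} (\<lambda>y. kern a y * cos (u * y))"

definition pos_hat :: "real \<Rightarrow> real \<Rightarrow> real" where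
  "pos_hat a u = max 0 (kern_hat a u)"

lemma kern_deriv: "(kern a has_real_derivative kern' a y) (at y within S)"
proof -
  define b where "b = pi\<^sup>2 / a\<^sup>2"
  have "((\<lambda>y. (1 - b) * (1 - y) * cos (pi * y) + (1 + b) * sin (pi * y) / pi) has_real_derivative
      2 * b * cos (pi * y) - pi * (1 - b) * (1 - y) * sin (pi * y)) (at y within S)"
    by (auto intro!: derivative_eq_intros) (simp add: field_simps)
  then show ?thesis by (simp add: kern_def[abs_def] kern'_def b_def)
qed

lemma kern'_deriv:
  "(kern' a has_real_derivative 2 * pi * (1 - pi\<^sup>2 / a\<^sup>2) * sin (pi * y) - pi\<^sup>2 * kern a y) (at y within S)"
proof -
  define b where "b = pi\<^sup>2 / a\<^sup>2"
  have "((\<lambda>y. 2 * b * cos (pi * y) - pi * (1 - b) * (1 - y) * sin (pi * y)) has_real_derivative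
      2 * pi * (1 - b) * sin (pi * y) - pi\<^sup>2 * ((1 - b) * (1 - y) * cos (pi * y) + (1 + b) * sin (pi * y) / pi)) (at y within S)"
    by (auto intro!: derivative_eq_intros) (simp add: field_simps power2_eq_square)
  then show ?thesis by (simp add: kern_def kern'_def[abs_def] b_def)
qed

lemma continuous_on_kern [continuous_intros]:
  assumes "continuous_on S f"
  shows "continuous_on S (\<lambda>x. kern a (f x))" "continuous_on S (\<lambda>x. kern' a (f x))"
  using DERIV_continuous_on[OF kern_deriv, of UNIV a] DERIV_continuous_on[OF kern'_deriv, of UNIV a] assms
  by (auto intro: continuous_on_compose2)

lemma abs_kern_le:
  assumes "a \<ge> 2 * pi" "0 \<le> y" "y \<le> 1"
  shows "\<bar>kern a y\<bar> \<le> 3"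
proof -
  have "pi \<le> a" using assms(1) pi_gt_zero by linarith
  then have "pi\<^sup>2 \<le> a\<^sup>2" by (intro power_mono) auto
  moreover have "a > 0" using assms(1) pi_gt_zero by linarith
  ultimately have b: "0 \<le> pi\<^sup>2 / a\<^sup>2" "pi\<^sup>2 / a\<^sup>2 \<le> 1" by auto
  have "\<bar>(1 - pi\<^sup>2 / a\<^sup>2) * (1 - y) * cos (pi * y)\<bar> \<le> 1 * 1 * 1"
    unfolding abs_mult using b assms by (intro mult_mono) auto
  moreover have "\<bar>(1 + pi\<^sup>2 / a\<^sup>2) * sin (pi * y) / pi\<bar> \<le> 2 * 1 / 1"
    unfolding abs_mult abs_divide using b pi_ge_two by (intro frac_le mult_mono) auto
  ultimately show ?thesis unfolding kern_def by linarith
qed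

text \<open>
  The antiderivative comes from \<open>kern'' + \<pi>\<^sup>2 kern = 2 \<pi> (1 - b) sin (\<pi> y)\<close> with \<open>b = \<pi>\<^sup>2 / a\<^sup>2\<close>: two
  integrations by parts reduce the transform of \<open>kern a\<close> to that of the sine. At \<open>u = \<plusminus>\<pi>\<close> the
  formula has a removable singularity.
\<close>

lemma kern_hat_closed_form:
  assumes "a > 0" "u\<^sup>2 \<noteq> pi\<^sup>2"
  shows "kern_hat a u = 2 * pi\<^sup>2 * (1 + cos u) * (1 - u\<^sup>2 / a\<^sup>2) / (pi\<^sup>2 - u\<^sup>2)\<^sup>2"
proof -
  define b where "b = pi\<^sup>2 / a\<^sup>2"
  define r where "r = pi\<^sup>2 - u\<^sup>2"
  have r: "r \<noteq> 0" using assms by (simp add: r_def)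
  define A where "A = (\<lambda>y. kern' a y * cos (u * y) + u * kern a y * sin (u * y))"
  define B where "B = (\<lambda>y. pi * cos (pi * y) * cos (u * y) + u * sin (pi * y) * sin (u * y))"
  define G where "G = (\<lambda>y. - A y / r - 2 * pi * (1 - b) * B y / r\<^sup>2)"
  have A: "(A has_real_derivative
      (2 * pi * (1 - b) * sin (pi * y) - pi\<^sup>2 * kern a y) * cos (u * y) + u\<^sup>2 * kern a y * cos (u * y)) (at y within {0..1})" for y
    unfolding A_def
    by (rule derivative_eq_intros kern_deriv kern'_deriv refl)+
       (simp add: b_def power2_eq_square algebra_simps)
  have B: "(B has_real_derivative - r * sin (pi * y) * cos (u * y)) (at y within {0..1})" for y
    unfolding B_def r_def by (auto intro!: derivative_eq_intros) (simp add: power2_eq_square algebra_simps)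
  have "(G has_real_derivative kern a y * cos (u * y)) (at y within {0..1})" for y
  proof -
    have "(G has_real_derivative
       - ((2 * pi * (1 - b) * sin (pi * y) - pi\<^sup>2 * kern a y) * cos (u * y) + u\<^sup>2 * kern a y * cos (u * y)) / r
       - 2 * pi * (1 - b) * (- r * sin (pi * y) * cos (u * y)) / r\<^sup>2) (at y within {0..1})"
      unfolding G_def by (intro DERIV_diff DERIV_cdivide DERIV_cmult DERIV_minus A B)
    also have "- ((2 * pi * (1 - b) * sin (pi * y) - pi\<^sup>2 * kern a y) * cos (u * y) + u\<^sup>2 * kern a y * cos (u * y)) / r
       - 2 * pi * (1 - b) * (- r * sin (pi * y) * cos (u * y)) / r\<^sup>2 = (pi\<^sup>2 - u\<^sup>2) * (kern a y * cos (u * y)) / r"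
      using r by (simp add: field_simps power2_eq_square)
    also have "\<dots> = kern a y * cos (u * y)" using r by (simp add: r_def)
    finally show ?thesis .
  qed
  then have "((\<lambda>y. kern a y * cos (u * y)) has_integral G 1 - G 0) {0..1}"
    by (intro fundamental_theorem_of_calculus) (auto simp: has_real_derivative_iff_has_vector_derivative)
  then have "kern_hat a u = G 1 - G 0" unfolding kern_hat_def by (rule integral_unique)
  also have "G 1 - G 0 = (2 * b * (1 + cos u)) / r + 2 * pi\<^sup>2 * (1 - b) * (1 + cos u) / r\<^sup>2"
  proof -
    have "A 1 = - 2 * b * cos u" "A 0 = 2 * b" "B 1 = - pi * cos u" "B 0 = pi"
      by (simp_all add: A_def B_def kern_def kern'_def b_def)
    then show ?thesis
      by (simp add: G_def diff_divide_distrib add_divide_distrib power2_eq_square algebra_simps)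
  qed
  also have "\<dots> = 2 * (1 + cos u) * (b * r + pi\<^sup>2 * (1 - b)) / r\<^sup>2"
    using r by (simp add: field_simps power2_eq_square)
  also have "b * r + pi\<^sup>2 * (1 - b) = pi\<^sup>2 * (1 - u\<^sup>2 / a\<^sup>2)"
    using assms by (simp add: b_def r_def field_simps)
  finally show ?thesis by (simp add: r_def)
qed

lemma continuous_on_kern_hat [continuous_intros]:
  assumes "continuous_on S f" shows "continuous_on S (\<lambda>x. kern_hat a (f x))"
proof -
  have "continuous_on UNIV (\<lambda>u. integral (cbox 0 1) (\<lambda>y. kern a y * cos (u * y)))"
    by (rule integral_continuous_on_param) (auto simp: case_prod_unfold intro!: continuous_intros)
  then have "continuous_on UNIV (kern_hat a)" unfolding kern_hat_def[abs_def] by simp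
  then show ?thesis using assms by (rule continuous_on_compose2) auto
qed

lemma continuous_on_pos_hat [continuous_intros]:
  "continuous_on S f \<Longrightarrow> continuous_on S (\<lambda>x. pos_hat a (f x))"
  unfolding pos_hat_def by (intro continuous_intros)

lemma pos_hat_nonneg [simp]: "pos_hat a u \<ge> 0" by (simp add: pos_hat_def)
lemma kern_hat_le_pos_hat: "kern_hat a u \<le> pos_hat a u" by (simp add: pos_hat_def)

lemma kern_hat_minus [simp]: "kern_hat a (- u) = kern_hat a u" by (simp add: kern_hat_def)
lemma pos_hat_minus [simp]: "pos_hat a (- u) = pos_hat a u" by (simp add: pos_hat_def)

lemma kern_hat_nonneg:
  assumes a: "a \<ge> 2 * pi" and u: "\<bar>u\<bar> \<le> a"
  shows "kern_hat a u \<ge> 0"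
proof -
  have *: "kern_hat a v \<ge> 0" if v: "\<bar>v\<bar> \<le> a" "v\<^sup>2 \<noteq> pi\<^sup>2" for v
  proof -
    have "a > 0" using a pi_gt_zero by linarith
    have "v\<^sup>2 \<le> a\<^sup>2" using v a pi_gt_zero by (simp add: abs_le_square_iff[symmetric])
    then have "1 - v\<^sup>2 / a\<^sup>2 \<ge> 0" using \<open>a > 0\<close> by simp
    moreover have "1 + cos v \<ge> 0" using cos_ge_minus_one[of v] by linarith
    ultimately show ?thesis unfolding kern_hat_closed_form[OF \<open>a > 0\<close> v(2)]
      by (intro divide_nonneg_nonneg mult_nonneg_nonneg) auto
  qed
  show ?thesis
  proof (cases "u\<^sup>2 = pi\<^sup>2")
    case False
    then show ?thesis using * u by blast
  next
    case True
    then have u': "\<bar>u\<bar> = pi" by (simp add: power2_eq_iff abs_if) (use pi_gt_zero in auto)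
    \<comment> \<open>At the removable singularities nonnegativity follows by continuity.\<close>
    have "isCont (kern_hat a) u"
      using continuous_on_kern_hat[OF continuous_on_id, of UNIV a] by (simp add: continuous_on_eq_continuous_at)
    then have "(kern_hat a \<longlongrightarrow> kern_hat a u) (at u)" by (simp add: isCont_def)
    moreover have "eventually (\<lambda>v. kern_hat a v \<ge> 0) (at u)"
      unfolding eventually_at
    proof (intro exI[of _ pi] conjI ballI impI)
      fix v assume v: "v \<in> UNIV" "v \<noteq> u \<and> dist v u < pi"
      then have "\<bar>v\<bar> \<le> a" using u' a by (auto simp: dist_real_def)
      moreover have "v\<^sup>2 \<noteq> pi\<^sup>2" using v u' by (auto simp: power2_eq_iff dist_real_def abs_if split: if_splits)
      ultimately show "kern_hat a v \<ge> 0" using * by blast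
    qed auto
    ultimately show ?thesis by (rule tendsto_lowerbound) auto
  qed
qed

lemma kern_hat_outside:
  assumes a: "a \<ge> 2 * pi" and u: "\<bar>u\<bar> \<ge> a"
  shows "kern_hat a u \<le> 0" "- kern_hat a u \<le> 16 * pi\<^sup>2 / (a\<^sup>2 * (1 + u\<^sup>2))"
proof -
  have a0: "a > 0" "a \<ge> 2" using a pi_gt_zero pi_ge_two by linarith+
  have ua: "u\<^sup>2 \<ge> a\<^sup>2" using u a0 by (simp add: abs_le_square_iff[symmetric])
  have "a\<^sup>2 \<ge> (2 * pi)\<^sup>2" using a by (intro power_mono) auto
  then have up: "u\<^sup>2 \<ge> 4 * pi\<^sup>2" using ua by simp
  have "pi\<^sup>2 > 0" by simp
  then have ne: "u\<^sup>2 \<noteq> pi\<^sup>2" using up by linarith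
  have "a\<^sup>2 \<ge> 2\<^sup>2" using a0 by (intro power_mono) auto
  then have u4: "u\<^sup>2 \<ge> 4" using ua by simp
  have c: "0 \<le> 1 + cos u" "1 + cos u \<le> 2" using cos_ge_minus_one[of u] cos_le_one[of u] by linarith+
  define N where "N = - kern_hat a u"
  have N: "N = 2 * pi\<^sup>2 * (1 + cos u) * (u\<^sup>2 / a\<^sup>2 - 1) / (pi\<^sup>2 - u\<^sup>2)\<^sup>2"
    unfolding N_def kern_hat_closed_form[OF a0(1) ne] by (simp add: minus_divide_left right_diff_distrib)
  have "0 \<le> u\<^sup>2 / a\<^sup>2 - 1" using ua a0 by simp
  then have "0 \<le> N" unfolding N using c by (intro divide_nonneg_nonneg mult_nonneg_nonneg) auto
  then show "kern_hat a u \<le> 0" by (simp add: N_def)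
  have "(3/4 * u\<^sup>2)\<^sup>2 \<le> (u\<^sup>2 - pi\<^sup>2)\<^sup>2" using up by (intro power_mono) auto
  then have d: "9/16 * (u\<^sup>2)\<^sup>2 \<le> (pi\<^sup>2 - u\<^sup>2)\<^sup>2" by (simp only: power2_commute[of "u\<^sup>2"] power_mult_distrib) (simp add: power2_eq_square)
  have "N \<le> (2 * pi\<^sup>2 * 2 * (u\<^sup>2 / a\<^sup>2)) / (9/16 * (u\<^sup>2)\<^sup>2)"
    unfolding N using c d u4 \<open>0 \<le> u\<^sup>2 / a\<^sup>2 - 1\<close> by (intro frac_le mult_mono mult_nonneg_nonneg) auto
  also have "\<dots> = 64 / 9 * pi\<^sup>2 / (a\<^sup>2 * u\<^sup>2)"
    using a0 u4 by (simp add: field_simps power2_eq_square)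
  also have "\<dots> \<le> 8 * pi\<^sup>2 / (a\<^sup>2 * ((1 + u\<^sup>2) / 2))"
    using a0 u4 by (intro frac_le mult_mono) auto
  also have "\<dots> = 16 * pi\<^sup>2 / (a\<^sup>2 * (1 + u\<^sup>2))" by simp
  finally show "- kern_hat a u \<le> 16 * pi\<^sup>2 / (a\<^sup>2 * (1 + u\<^sup>2))" by (simp add: N_def)
qed

lemma pos_hat_outside: "a \<ge> 2 * pi \<Longrightarrow> \<bar>u\<bar> \<ge> a \<Longrightarrow> pos_hat a u = 0"
  using kern_hat_outside(1)[of a u] by (simp add: pos_hat_def)

lemma kern_hat_ge_pos_hat:
  assumes a: "a \<ge> 2 * pi"
  shows "kern_hat a u \<ge> pos_hat a u - 16 * pi\<^sup>2 / (a\<^sup>2 * (1 + u\<^sup>2))"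
proof (cases "\<bar>u\<bar> \<le> a")
  case True
  then have "kern_hat a u = pos_hat a u" using kern_hat_nonneg[OF a] by (simp add: pos_hat_def)
  moreover have "16 * pi\<^sup>2 / (a\<^sup>2 * (1 + u\<^sup>2)) \<ge> 0" by simp
  ultimately show ?thesis by linarith
next
  case False
  then show ?thesis using kern_hat_outside(2)[OF a, of u] pos_hat_outside[OF a, of u] by auto
qed

text \<open>
  The total mass of the positive part.
\<close>

definition hat_mass :: "real \<Rightarrow> real" where
  "hat_mass a = integral {-a..a} (pos_hat a)"

lemma pos_hat_integrable: "pos_hat a integrable_on {p..q}"
  by (intro integrable_continuous_real continuous_intros)

text \<open>
  The bound does not depend on \<open>a\<close>, whereas by \<open>kern_hat_outside\<close> the negative part of
  \<^term>\<open>kern_hat a\<close> has mass at most a constant times \<open>1 / a\<^sup>2\<close>; for large \<open>a\<close> the negative part is therefore relatively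
  negligible.
\<close>

lemma hat_mass_ge:
  assumes a: "a \<ge> 2 * pi"
  shows "hat_mass a \<ge> 3 / pi\<^sup>2"
proof -
  have a2: "a \<ge> 2" using a pi_ge_two by linarith
  have pw: "3 / (2 * pi\<^sup>2) \<le> pos_hat a u" if u: "u \<in> {-1..1}" for u
  proof -
    have u1: "\<bar>u\<bar> \<le> 1" using u by auto
    then have u2: "u\<^sup>2 \<le> 1" by (simp add: abs_square_le_1)
    have "2\<^sup>2 \<le> pi\<^sup>2" using pi_ge_two by (intro power_mono) auto
    then have p4: "pi\<^sup>2 \<ge> 4" by simp
    have "2\<^sup>2 \<le> a\<^sup>2" using a2 by (intro power_mono) auto
    then have "u\<^sup>2 / a\<^sup>2 \<le> 1 / 4" using u2 by (intro frac_le) auto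
    then have 1: "3 / 4 \<le> 1 - u\<^sup>2 / a\<^sup>2" by simp
    have "cos u \<ge> 0" using u1 pi_ge_two by (intro cos_ge_zero) auto
    then have 2: "1 \<le> 1 + cos u" by simp
    have "(pi\<^sup>2 - u\<^sup>2)\<^sup>2 \<le> (pi\<^sup>2)\<^sup>2" using u2 p4 by (intro power_mono) auto
    moreover have "0 < (pi\<^sup>2 - u\<^sup>2)\<^sup>2" using u2 p4 by auto
    ultimately have "2 * pi\<^sup>2 * 1 * (3/4) / (pi\<^sup>2)\<^sup>2 \<le> 2 * pi\<^sup>2 * (1 + cos u) * (1 - u\<^sup>2 / a\<^sup>2) / (pi\<^sup>2 - u\<^sup>2)\<^sup>2"
      using 1 2 by (intro frac_le mult_mono mult_nonneg_nonneg order_trans[OF _ 1]) auto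
    also have "\<dots> = kern_hat a u" using u2 p4 a2 by (intro kern_hat_closed_form[symmetric]) auto
    also have "\<dots> \<le> pos_hat a u" by (rule kern_hat_le_pos_hat)
    finally show ?thesis by (simp add: power2_eq_square)
  qed
  have "3 / pi\<^sup>2 = integral {-1..1::real} (\<lambda>u. 3 / (2 * pi\<^sup>2))" by simp
  also have "\<dots> \<le> integral {-1..1} (pos_hat a)"
    by (rule integral_le) (auto intro: pos_hat_integrable pw)
  also have "\<dots> \<le> hat_mass a"
    unfolding hat_mass_def using a2 by (intro integral_subset_le pos_hat_integrable) auto
  finally show ?thesis .
qed

lemma pos_hat_scaled_has_integral:
  assumes a: "a \<ge> 2 * pi" and l: "l > 0" and pq: "p \<le> T - a / l" "T + a / l \<le> q"
  shows "((\<lambda>u. pos_hat a (l * (u - T))) has_integral hat_mass a / l) {p..q}"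
proof -
  have "(pos_hat a has_integral hat_mass a) (cbox (-a) a)"
    unfolding hat_mass_def using pos_hat_integrable[of a "-a" a] by (simp add: integrable_integral)
  from has_integral_affinity[OF this, of l "- l * T"]
  have "((\<lambda>u. pos_hat a (l * (u - T))) has_integral hat_mass a / l) ((\<lambda>x. x / l + T) ` {-a..a})"
    using l by (simp add: algebra_simps)
  also have "(\<lambda>x. x / l + T) ` {-a..a} = {T - a / l..T + a / l}"
  proof (intro equalityI subsetI)
    fix x assume "x \<in> {T - a / l..T + a / l}"
    then have "x = (l * (x - T)) / l + T" "l * (x - T) \<in> {-a..a}"
      using l by (auto simp: field_simps)
    then show "x \<in> (\<lambda>x. x / l + T) ` {-a..a}" by blast
  next
    fix x assume "x \<in> (\<lambda>x. x / l + T) ` {-a..a}"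
    then obtain v where v: "x = v / l + T" "-a \<le> v" "v \<le> a" by force
    from v(2,3) l have "(-a) / l \<le> v / l" "v / l \<le> a / l"
      by (intro divide_right_mono; simp)+
    then show "x \<in> {T - a / l..T + a / l}" unfolding v(1) by auto
  qed
  finally show ?thesis
  proof (rule has_integral_on_superset)
    show "pos_hat a (l * (u - T)) = 0" if "u \<notin> {T - a / l..T + a / l}" for u
    proof (rule pos_hat_outside[OF a])
      from that have "a / l \<le> \<bar>u - T\<bar>" by auto
      then have "a \<le> l * \<bar>u - T\<bar>" using l by (simp add: field_simps)
      also have "\<dots> = \<bar>l * (u - T)\<bar>" unfolding abs_mult using l by simp
      finally show "a \<le> \<bar>l * (u - T)\<bar>" .
    qed
  qed (use pq in auto)
qed

section \<open>Local lower bounds for weighted sums of the von Mangoldt function\<close>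

lemma Re_of_real_mult: "Re (of_real r * z) = r * Re z" by simp

text \<open>
  The Riemann-Lebesgue lemma for continuously differentiable functions, by one integration by
  parts.
\<close>

lemma riemann_lebesgue_C1:
  fixes f f' :: "real \<Rightarrow> complex"
  assumes f: "\<And>y. y \<in> {0..1} \<Longrightarrow> (f has_vector_derivative f' y) (at y within {0..1})"
    and f': "continuous_on {0..1} f'"
  shows "((\<lambda>\<tau>. integral {0..1} (\<lambda>y. f y * exp (\<i> * of_real (\<tau> * y)))) \<longlongrightarrow> 0) at_top"
proof -
  have cf: "continuous_on {0..1} f"
    using f by (meson continuous_on_eq_continuous_within has_vector_derivative_continuous)
  obtain B where B: "\<And>y. y \<in> {0..1} \<Longrightarrow> norm (f' y) \<le> B"
    using compact_imp_bounded[OF compact_continuous_image[OF f' compact_Icc]] unfolding bounded_iff by blast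
  define C where "C = norm (f 1) + norm (f 0) + B"
  have lim: "((\<lambda>\<tau>. C / \<tau>) \<longlongrightarrow> 0) at_top"
    by (intro tendsto_divide_0[OF tendsto_const] filterlim_at_top_imp_at_infinity filterlim_ident)
  have "\<forall>\<^sub>F \<tau> in at_top. norm (integral {0..1} (\<lambda>y. f y * exp (\<i> * of_real (\<tau> * y)))) \<le> C / \<tau>"
    using eventually_gt_at_top[of 0]
  proof eventually_elim
    case (elim \<tau>)
    define e where "e = (\<lambda>y::real. exp (\<i> * of_real (\<tau> * y)))"
    have ne: "norm (e y) = 1" for y by (simp add: e_def)
    have ce: "continuous_on {0..1} e" unfolding e_def by (intro continuous_intros)
    define G where "G = (\<lambda>y. f y * e y / (\<i> * of_real \<tau>))"
    have de: "(e has_vector_derivative \<i> * of_real \<tau> * e y) (at y within {0..1})" for y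
    proof -
      have "((\<lambda>z. exp (\<i> * (of_real \<tau> * z))) has_field_derivative \<i> * of_real \<tau> * exp (\<i> * (of_real \<tau> * z))) (at z)" for z :: complex
        by (auto intro!: derivative_eq_intros)
      from has_vector_derivative_real_field[OF this] show ?thesis
        unfolding e_def by (auto intro: has_vector_derivative_at_within)
    qed
    have "(G has_vector_derivative (f' y * e y / (\<i> * of_real \<tau>) + f y * e y)) (at y within {0..1})" if y: "y \<in> {0..1}" for y
    proof -
      have "((\<lambda>y. f y * e y) has_vector_derivative (f y * (\<i> * of_real \<tau> * e y) + f' y * e y)) (at y within {0..1})"
        by (rule has_vector_derivative_mult[OF f[OF y] de])
      from has_vector_derivative_mult_left[OF this, of "1 / (\<i> * of_real \<tau>)"] show ?thesis
        using elim by (simp add: G_def field_simps)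
    qed
    then have "((\<lambda>y. f' y * e y / (\<i> * of_real \<tau>) + f y * e y) has_integral G 1 - G 0) {0..1}"
      by (intro fundamental_theorem_of_calculus) auto
    moreover have i1: "(\<lambda>y. f' y * e y / (\<i> * of_real \<tau>)) integrable_on {0..1}"
      using elim by (intro integrable_continuous_real continuous_intros f' ce) auto
    moreover have i2: "(\<lambda>y. f y * e y) integrable_on {0..1}"
      by (intro integrable_continuous_real continuous_intros cf ce)
    ultimately have "integral {0..1} (\<lambda>y. f y * e y) = G 1 - G 0 - integral {0..1} (\<lambda>y. f' y * e y / (\<i> * of_real \<tau>))"
      using integral_add[OF i1 i2] by (simp add: integral_unique algebra_simps)
    also have "norm \<dots> \<le> norm (G 1) + norm (G 0) + norm (integral {0..1} (\<lambda>y. f' y * e y / (\<i> * of_real \<tau>)))"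
      using norm_triangle_ineq4[of "G 1 - G 0"] norm_triangle_ineq4[of "G 1" "G 0"]
      by (smt (verit, best))
    also have "norm (integral {0..1} (\<lambda>y. f' y * e y / (\<i> * of_real \<tau>))) \<le> B / \<tau> * (1 - 0)"
    proof (rule integral_bound)
      show "continuous_on {0..1} (\<lambda>y. f' y * e y / (\<i> * of_real \<tau>))"
        using elim by (intro continuous_intros f' ce) auto
      show "norm (f' y * e y / (\<i> * of_real \<tau>)) \<le> B / \<tau>" if "y \<in> {0..1}" for y
        using B[OF that] elim by (simp add: norm_mult norm_divide ne divide_right_mono)
    qed auto
    finally have "norm (integral {0..1} (\<lambda>y. f y * e y)) \<le> C / \<tau>" using elim
      by (simp add: G_def C_def norm_mult norm_divide ne add_divide_distrib)
    then show ?case by (simp only: e_def)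
  qed
  then show ?thesis using lim by (rule Lim_null_comparison)
qed

text \<open>
  The contribution of the pole of zeta. The left-hand side is the integral of
  \<open>exp (- \<delta> u) * kern_hat a (l (u - T))\<close> over \<open>u \<ge> 0\<close>, which is computed on \<open>[0, U]\<close> and then passed
  to the limit. The positive part of the transform gives the first term on the right and its
  negative part the second.
\<close>

lemma main_term_lower_bound:
  assumes a: "a \<ge> 2 * pi" and l: "l > 0" and d: "\<delta> > 0" and T: "T \<ge> a / l"
  shows "integral {0..1} (\<lambda>y. kern a y * Re (exp (\<i> * of_real (l * T * y)) / (of_real \<delta> + \<i> * of_real (l * y))))
    \<ge> exp (- \<delta> * (T + a / l)) * (hat_mass a / l) - 16 * pi ^ 3 / (a\<^sup>2 * l)" (is "?L \<ge> ?R")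
proof -
  define s where "s = (\<lambda>y. of_real \<delta> + \<i> * complex_of_real (l * y))"
  have s0: "s y \<noteq> 0" for y using d by (auto simp: s_def complex_eq_iff)
  have ns: "norm (s y) \<ge> \<delta>" for y
    using complex_Re_le_cmod[of "s y"] by (simp add: s_def)
  have cs: "continuous_on A s" for A unfolding s_def by (intro continuous_intros)
  define e where "e = (\<lambda>y. exp (\<i> * complex_of_real (l * T * y)))"
  have ne: "norm (e y) = 1" for y by (simp add: e_def)
  have ce: "continuous_on A e" for A unfolding e_def by (intro continuous_intros)
  have a0: "a > 0" using a pi_gt_zero by linarith
  define W where "W = (\<lambda>U. integral {0..U} (\<lambda>u. exp (- \<delta> * u) * kern_hat a (l * (u - T))))"
  have W_eq: "W U = ?L - integral {0..1} (\<lambda>y. kern a y * Re (e y * exp (- s y * of_real U) / s y))" if U: "U \<ge> 0" for U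
  proof -
    have "W U = integral (cbox 0 U) (\<lambda>u. integral (cbox 0 1) (\<lambda>y. exp (- \<delta> * u) * (kern a y * cos (l * (u - T) * y))))"
      by (simp add: W_def kern_hat_def)
    \<comment> \<open>On a compact rectangle the order of integration can be exchanged.\<close>
    also have "\<dots> = integral (cbox 0 1) (\<lambda>y. integral (cbox 0 U) (\<lambda>u. exp (- \<delta> * u) * (kern a y * cos (l * (u - T) * y))))"
      by (rule integral_swap_continuous) (auto simp: case_prod_unfold intro!: continuous_intros)
    also have "\<dots> = integral {0..1} (\<lambda>y. kern a y * Re (e y / s y) - kern a y * Re (e y * exp (- s y * of_real U) / s y))"
    proof (unfold cbox_interval, rule integral_cong)
      fix y :: real
      define Q where "Q = (\<lambda>u::real. - Re (e y * exp (- s y * of_real u) / s y))"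
      have "(Q has_real_derivative exp (- \<delta> * u) * cos (l * (u - T) * y)) (at u within {0..U})" for u
      proof -
        have "((\<lambda>z. - (e y * exp (- s y * z) / s y)) has_field_derivative e y * exp (- s y * of_real u)) (at (of_real u))"
          using s0[of y] by (auto intro!: derivative_eq_intros)
        from has_vector_derivative_real_field[OF this]
        have "((\<lambda>u. - (e y * exp (- s y * of_real u) / s y)) has_vector_derivative e y * exp (- s y * of_real u)) (at u within {0..U})"
          by (rule has_vector_derivative_at_within)
        from bounded_linear.has_vector_derivative[OF bounded_linear_Re this]
        have "(Q has_real_derivative Re (e y * exp (- s y * of_real u))) (at u within {0..U})"
          by (simp add: Q_def has_real_derivative_iff_has_vector_derivative)
        moreover have "e y * exp (- s y * of_real u) = exp (of_real (- \<delta> * u) + \<i> * of_real (- (l * (u - T) * y)))"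
          by (simp add: e_def s_def exp_add[symmetric] algebra_simps)
        then have "Re (e y * exp (- s y * of_real u)) = exp (- \<delta> * u) * cos (l * (u - T) * y)"
          by (simp add: Re_exp)
        ultimately show ?thesis by simp
      qed
      then have "((\<lambda>u. exp (- \<delta> * u) * cos (l * (u - T) * y)) has_integral Q U - Q 0) {0..U}"
        using U by (intro fundamental_theorem_of_calculus) (auto simp: has_real_derivative_iff_has_vector_derivative)
      then have "((\<lambda>u. kern a y * (exp (- \<delta> * u) * cos (l * (u - T) * y))) has_integral kern a y * (Q U - Q 0)) {0..U}"
        by (rule has_integral_mult_right)
      then have "integral {0..U} (\<lambda>u. exp (- \<delta> * u) * (kern a y * cos (l * (u - T) * y))) = kern a y * (Q U - Q 0)"
        by (intro integral_unique) (simp add: mult_ac)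
      then show "integral {0..U} (\<lambda>u. exp (- \<delta> * u) * (kern a y * cos (l * (u - T) * y))) =
          kern a y * Re (e y / s y) - kern a y * Re (e y * exp (- s y * of_real U) / s y)"
        by (simp add: Q_def algebra_simps)
    qed
    also have "\<dots> = integral {0..1} (\<lambda>y. kern a y * Re (e y / s y)) - integral {0..1} (\<lambda>y. kern a y * Re (e y * exp (- s y * of_real U) / s y))"
      by (intro integral_diff integrable_continuous_real continuous_intros ce cs) (auto simp: s0)
    finally show ?thesis by (simp add: e_def s_def)
  qed
  have err: "\<bar>integral {0..1} (\<lambda>y. kern a y * Re (e y * exp (- s y * of_real U) / s y))\<bar> \<le> 3 * (exp (- \<delta> * U) / \<delta>)" for U
  proof -
    have "norm (integral {0..1} (\<lambda>y. kern a y * Re (e y * exp (- s y * of_real U) / s y))) \<le> 3 * (exp (- \<delta> * U) / \<delta>) * (1 - 0)"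
    proof (rule integral_bound)
      show "continuous_on {0..1} (\<lambda>y. kern a y * Re (e y * exp (- s y * of_real U) / s y))"
        by (intro continuous_intros ce cs) (auto simp: s0)
      show "norm (kern a y * Re (e y * exp (- s y * of_real U) / s y)) \<le> 3 * (exp (- \<delta> * U) / \<delta>)" if y: "y \<in> {0..1}" for y
      proof -
        have "\<bar>Re (e y * exp (- s y * of_real U) / s y)\<bar> \<le> norm (e y * exp (- s y * of_real U) / s y)"
          by (rule abs_Re_le_cmod)
        also have "\<dots> = exp (- \<delta> * U) / norm (s y)"
          by (simp add: norm_mult norm_divide ne) (simp add: s_def)
        also have "\<dots> \<le> exp (- \<delta> * U) / \<delta>"
          using d ns[of y] by (intro frac_le) auto
        finally show ?thesis
          using abs_kern_le[OF a, of y] y by (simp only: real_norm_def abs_mult) (intro mult_mono, auto)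
      qed
    qed auto
    then show ?thesis by simp
  qed
  have "((\<lambda>U. exp (- \<delta> * U)) \<longlongrightarrow> 0) at_top" using d by real_asymp
  then have "((\<lambda>U. 3 * (exp (- \<delta> * U) / \<delta>)) \<longlongrightarrow> 0) at_top"
    by (intro tendsto_mult_right_zero tendsto_divide_zero)
  then have "((\<lambda>U. integral {0..1} (\<lambda>y. kern a y * Re (e y * exp (- s y * of_real U) / s y))) \<longlongrightarrow> 0) at_top"
    by (rule Lim_null_comparison[rotated]) (use err in auto)
  then have "((\<lambda>U. ?L - integral {0..1} (\<lambda>y. kern a y * Re (e y * exp (- s y * of_real U) / s y))) \<longlongrightarrow> ?L - 0) at_top"
    by (intro tendsto_diff tendsto_const)
  moreover have "\<forall>\<^sub>F U in at_top. ?R \<le> ?L - integral {0..1} (\<lambda>y. kern a y * Re (e y * exp (- s y * of_real U) / s y))"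
    using eventually_ge_at_top[of "T + a / l"]
  proof eventually_elim
    case (elim U)
    have al: "a / l > 0" using a0 l by simp
    have U0: "U \<ge> 0" using elim al T by linarith
    define K where "K = exp (- \<delta> * (T + a / l))"
    have i1: "((\<lambda>u. K * pos_hat a (l * (u - T))) has_integral K * (hat_mass a / l)) {0..U}"
      using elim T by (intro has_integral_mult_right pos_hat_scaled_has_integral a l) auto
    \<comment> \<open>The bound for the negative part of the transform has an arctangent as its antiderivative.\<close>
    define A where "A = (\<lambda>u. arctan (l * (u - T)) / l)"
    have "(A has_real_derivative 1 / (1 + (l * (u - T))\<^sup>2)) (at u within {0..U})" for u
    proof -
      have "((\<lambda>u. arctan (l * (u - T))) has_real_derivative l * (1 / (1 + (l * (u - T))\<^sup>2))) (at u within {0..U})"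
        by (auto intro!: derivative_eq_intros simp: inverse_eq_divide)
      from DERIV_cdivide[OF this, of l] show ?thesis using l by (simp add: A_def)
    qed
    then have "((\<lambda>u. 1 / (1 + (l * (u - T))\<^sup>2)) has_integral A U - A 0) {0..U}"
      using U0 by (intro fundamental_theorem_of_calculus) (auto simp: has_real_derivative_iff_has_vector_derivative)
    from has_integral_diff[OF i1 has_integral_mult_right[OF this, of "16 * pi\<^sup>2 / a\<^sup>2"]]
    have i2: "((\<lambda>u. K * pos_hat a (l * (u - T)) - 16 * pi\<^sup>2 / a\<^sup>2 * (1 / (1 + (l * (u - T))\<^sup>2))) has_integral
       K * (hat_mass a / l) - 16 * pi\<^sup>2 / a\<^sup>2 * (A U - A 0)) {0..U}" .
    have iW: "((\<lambda>u. exp (- \<delta> * u) * kern_hat a (l * (u - T))) has_integral W U) {0..U}"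
      unfolding W_def by (intro integrable_integral integrable_continuous_real continuous_intros)
    have "A U - A 0 \<le> pi / l"
      using arctan_ubound[of "l * (U - T)"] arctan_lbound[of "l * (0 - T)"] l
      by (simp add: A_def diff_divide_distrib[symmetric] divide_right_mono)
    then have "16 * pi\<^sup>2 / a\<^sup>2 * (A U - A 0) \<le> 16 * pi\<^sup>2 / a\<^sup>2 * (pi / l)"
      by (intro mult_left_mono) auto
    also have "\<dots> = 16 * pi ^ 3 / (a\<^sup>2 * l)" by (simp add: power2_eq_square power3_eq_cube)
    finally have "?R \<le> K * (hat_mass a / l) - 16 * pi\<^sup>2 / a\<^sup>2 * (A U - A 0)" by (simp add: K_def)
    also have "\<dots> \<le> W U"
    proof (rule has_integral_le[OF i2 iW])
      fix u assume u: "u \<in> {0..U}"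
      define v where "v = l * (u - T)"
      have E: "exp (- \<delta> * u) \<le> 1" using d u by simp
      have "K * pos_hat a v \<le> exp (- \<delta> * u) * pos_hat a v"
      proof (cases "u \<le> T + a / l")
        case True
        then have "K \<le> exp (- \<delta> * u)" using d by (simp add: K_def)
        then show ?thesis by (rule mult_right_mono) simp
      next
        case False
        then have "a \<le> \<bar>v\<bar>" using l by (simp add: v_def field_simps)
        then show ?thesis by (simp add: pos_hat_outside[OF a])
      qed
      moreover have "exp (- \<delta> * u) * (16 * pi\<^sup>2 / (a\<^sup>2 * (1 + v\<^sup>2))) \<le> 1 * (16 * pi\<^sup>2 / (a\<^sup>2 * (1 + v\<^sup>2)))"
        using E by (intro mult_right_mono) auto
      moreover have "exp (- \<delta> * u) * (pos_hat a v - 16 * pi\<^sup>2 / (a\<^sup>2 * (1 + v\<^sup>2))) \<le> exp (- \<delta> * u) * kern_hat a v"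
        by (intro mult_left_mono kern_hat_ge_pos_hat a) auto
      moreover have "1 * (16 * pi\<^sup>2 / (a\<^sup>2 * (1 + v\<^sup>2))) = 16 * pi\<^sup>2 / a\<^sup>2 * (1 / (1 + v\<^sup>2))" by simp
      ultimately show "K * pos_hat a (l * (u - T)) - 16 * pi\<^sup>2 / a\<^sup>2 * (1 / (1 + (l * (u - T))\<^sup>2)) \<le> exp (- \<delta> * u) * kern_hat a (l * (u - T))"
        unfolding v_def[symmetric] by (simp only: right_diff_distrib[of "exp (- \<delta> * u)"])
    qed
    finally show ?case using W_eq[OF U0] by simp
  qed
  ultimately have "?R \<le> ?L - 0" by (rule tendsto_lowerbound) simp
  then show ?thesis by simp
qed

text \<open>
  Since the transform is an integral over the bounded interval \<open>[0, 1]\<close>, weighting the von Mangoldt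
  series by it amounts to integrating that series along a vertical segment.
\<close>

lemma mangoldt_kern_hat_sum_tendsto:
  assumes a: "a \<ge> 2 * pi" and d: "\<delta> > 0"
  shows "(\<lambda>N. \<Sum>n<N. mangoldt n * real n powr (- 1 - \<delta>) * kern_hat a (l * (ln (real n) - T)))
     \<longlonglongrightarrow> integral {0..1} (\<lambda>y. kern a y * Re (exp (\<i> * of_real (l * T * y)) * D_mangoldt (1 + of_real \<delta> + \<i> * of_real (l * y))))"
proof -
  define f where "f = (\<lambda>n y. mangoldt n * real n powr (- 1 - \<delta>) * (kern a y * cos (l * (ln (real n) - T) * y)))"
  have cf: "continuous_on {0..1} (f n)" for n unfolding f_def by (intro continuous_intros)
  have ul: "uniform_limit {0..1} (\<lambda>N y. \<Sum>n<N. f n y) (\<lambda>y. \<Sum>n. f n y) sequentially"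
  proof (rule Weierstrass_m_test)
    show "summable (\<lambda>n. mangoldt n * real n powr (- (1 + \<delta>)) * 3)"
      using d by (intro summable_mult2 summable_mangoldt_powr) auto
    show "norm (f n y) \<le> mangoldt n * real n powr (- (1 + \<delta>)) * 3" if "y \<in> {0..1}" for n y
    proof -
      have "\<bar>kern a y * cos (l * (ln (real n) - T) * y)\<bar> \<le> 3 * 1"
        unfolding abs_mult using abs_kern_le[OF a, of y] that by (intro mult_mono) auto
      then have "\<bar>mangoldt n * real n powr (- 1 - \<delta>)\<bar> * \<bar>kern a y * cos (l * (ln (real n) - T) * y)\<bar>
         \<le> \<bar>mangoldt n * real n powr (- 1 - \<delta>)\<bar> * 3" by (intro mult_left_mono) auto
      then show ?thesis by (simp add: f_def abs_mult mangoldt_nonneg)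
    qed
  qed
  obtain I L where IL: "\<And>N. ((\<lambda>y. \<Sum>n<N. f n y) has_integral I N) {0..1}"
      "((\<lambda>y. \<Sum>n. f n y) has_integral L) {0..1}" "I \<longlonglongrightarrow> L"
    by (rule uniform_limit_integral[OF ul]) (auto intro!: continuous_intros cf)
  have "I N = (\<Sum>n<N. mangoldt n * real n powr (- 1 - \<delta>) * kern_hat a (l * (ln (real n) - T)))" for N
  proof -
    have "I N = integral {0..1} (\<lambda>y. \<Sum>n<N. f n y)" using IL(1)[of N] by (rule integral_unique[symmetric])
    also have "\<dots> = (\<Sum>n<N. integral {0..1} (f n))"
      by (intro integral_sum integrable_continuous_real cf) auto
    also have "\<dots> = (\<Sum>n<N. mangoldt n * real n powr (- 1 - \<delta>) * kern_hat a (l * (ln (real n) - T)))"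
      unfolding f_def kern_hat_def by (intro sum.cong refl integral_mult_right)
    finally show ?thesis .
  qed
  then have "I = (\<lambda>N. \<Sum>n<N. mangoldt n * real n powr (- 1 - \<delta>) * kern_hat a (l * (ln (real n) - T)))" ..
  moreover have "L = integral {0..1} (\<lambda>y. kern a y * Re (exp (\<i> * of_real (l * T * y)) * D_mangoldt (1 + of_real \<delta> + \<i> * of_real (l * y))))"
  proof -
    have "(\<Sum>n. f n y) = kern a y * Re (exp (\<i> * of_real (l * T * y)) * D_mangoldt (1 + of_real \<delta> + \<i> * of_real (l * y)))" for y
    proof (rule sums_unique[symmetric])
      define s where "s = 1 + of_real \<delta> + \<i> * complex_of_real (l * y)"
      define e where "e = exp (\<i> * complex_of_real (l * T * y))"
      have "(\<lambda>n. kern a y * Re (e * (mangoldt n * npow n s))) sums (kern a y * Re (e * D_mangoldt s))"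
        using d by (intro sums_mult sums_Re D_mangoldt_sums) (simp add: s_def)
      moreover have "kern a y * Re (e * (mangoldt n * npow n s)) = f n y" for n
      proof (cases "n = 0")
        case False
        have "e * npow n s = exp (of_real ((- 1 - \<delta>) * ln (real n)) + \<i> * of_real (- (l * (ln (real n) - T) * y)))"
          using False by (simp add: e_def s_def powr_def Ln_of_nat exp_add[symmetric] algebra_simps)
        then have "Re (e * npow n s) = real n powr (- 1 - \<delta>) * cos (l * (ln (real n) - T) * y)"
          using False by (simp add: Re_exp powr_def)
        moreover have "e * (mangoldt n * npow n s) = of_real (mangoldt n) * (e * npow n s)" by simp
        ultimately show ?thesis by (simp only: Re_of_real_mult) (simp add: f_def)
      qed (simp add: f_def)
      ultimately show "(\<lambda>n. f n y) sums (kern a y * Re (e * D_mangoldt s))" by simp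
    qed
    then show ?thesis using integral_unique[OF IL(2)] by simp
  qed
  ultimately show ?thesis using IL(3) by (simp only:)
qed

text \<open>
  The contribution of the regular part \<^term>\<open>H_zeta\<close>, taken on the line \<open>Re s = 1\<close>.
\<close>

definition spectral_term :: "real \<Rightarrow> real \<Rightarrow> real \<Rightarrow> real" where
  "spectral_term a l T = integral {0..1} (\<lambda>y. kern a y * Re (exp (\<i> * of_real (l * T * y)) * H_zeta (1 + \<i> * of_real (l * y))))"

lemma spectral_term_tendsto_0:
  assumes "l > 0"
  shows "(spectral_term a l \<longlongrightarrow> 0) at_top"
proof -
  define R where "R = {s. Re s > 0 \<and> zetaC s \<noteq> 0}"
  have oR: "open R" and hR: "H_zeta holomorphic_on R" using H_zeta_holomorphic by (auto simp: R_def)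
  define z where "z = (\<lambda>y. 1 + \<i> * complex_of_real (l * y))"
  have zR: "z y \<in> R" for y using zetaC_nonzero[of "z y"] by (simp add: R_def z_def)
  define f where "f = (\<lambda>y. of_real (kern a y) * H_zeta (z y))"
  define f' where "f' = (\<lambda>y. of_real (kern a y) * (\<i> * of_real l * deriv H_zeta (z y)) + of_real (kern' a y) * H_zeta (z y))"
  have cz: "continuous_on {0..1} z" unfolding z_def by (intro continuous_intros)
  have cH: "continuous_on {0..1} (\<lambda>y. H_zeta (z y))" "continuous_on {0..1} (\<lambda>y. deriv H_zeta (z y))"
    using zR
    by (auto intro!: continuous_on_compose2[OF holomorphic_on_imp_continuous_on[OF hR] cz]
        continuous_on_compose2[OF holomorphic_on_imp_continuous_on[OF holomorphic_deriv[OF hR oR]] cz])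
  have df: "(f has_vector_derivative f' y) (at y within {0..1})" for y
  proof -
    have "((\<lambda>w. H_zeta (1 + \<i> * (of_real l * w))) has_field_derivative \<i> * of_real l * deriv H_zeta (z y)) (at (of_real y))"
    proof -
      have "(H_zeta has_field_derivative deriv H_zeta (z y)) (at (1 + \<i> * (of_real l * of_real y)))"
        using holomorphic_derivI[OF hR oR zR[of y]] by (simp add: z_def)
      from DERIV_chain2[where f = H_zeta and g = "\<lambda>w. 1 + \<i> * (of_real l * w)" and x = "of_real y" and Db = "\<i> * of_real l" and s = UNIV, OF this]
      have "((\<lambda>w. 1 + \<i> * (of_real l * w)) has_field_derivative \<i> * of_real l) (at (of_real y)) \<Longrightarrow> ?thesis"
        by (simp add: mult_ac)
      moreover have "((\<lambda>w. 1 + \<i> * (of_real l * w)) has_field_derivative \<i> * of_real l) (at (of_real y))"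
        by (auto intro!: derivative_eq_intros)
      ultimately show ?thesis by blast
    qed
    from has_vector_derivative_at_within[OF has_vector_derivative_real_field[OF this]]
    have "((\<lambda>y. H_zeta (z y)) has_vector_derivative \<i> * of_real l * deriv H_zeta (z y)) (at y within {0..1})"
      by (simp add: z_def)
    moreover have "((\<lambda>y. complex_of_real (kern a y)) has_vector_derivative of_real (kern' a y)) (at y within {0..1})"
      using kern_deriv[of a y "{0..1}"]
      by (intro has_vector_derivative_of_real) (simp add: has_real_derivative_iff_has_vector_derivative)
    ultimately show ?thesis unfolding f_def f'_def by (rule has_vector_derivative_mult[rotated])
  qed
  have "((\<lambda>\<tau>. integral {0..1} (\<lambda>y. f y * exp (\<i> * of_real (\<tau> * y)))) \<longlongrightarrow> 0) at_top"
    by (rule riemann_lebesgue_C1[OF df]) (auto simp: f'_def intro!: continuous_intros cH)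
  moreover have "filterlim (\<lambda>T. l * T) at_top at_top"
    using assms by (intro filterlim_tendsto_pos_mult_at_top[OF tendsto_const] filterlim_ident)
  ultimately have "((\<lambda>T. integral {0..1} (\<lambda>y. f y * exp (\<i> * of_real (l * T * y)))) \<longlongrightarrow> 0) at_top"
    by (rule filterlim_compose)
  from tendsto_Re[OF this]
  have "((\<lambda>T. Re (integral {0..1} (\<lambda>y. f y * exp (\<i> * of_real (l * T * y))))) \<longlongrightarrow> 0) at_top" by simp
  moreover have "Re (integral {0..1} (\<lambda>y. f y * exp (\<i> * of_real (l * T * y)))) = spectral_term a l T" for T
  proof -
    have "(\<lambda>y. f y * exp (\<i> * of_real (l * T * y))) integrable_on {0..1}"
      unfolding f_def by (intro integrable_continuous_real continuous_intros cH)
    from has_integral_Re[OF integrable_integral[OF this]]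
    have "Re (integral {0..1} (\<lambda>y. f y * exp (\<i> * of_real (l * T * y)))) = integral {0..1} (\<lambda>y. Re (f y * exp (\<i> * of_real (l * T * y))))"
      by (rule integral_unique[symmetric])
    moreover have "Re (f y * exp (\<i> * of_real (l * T * y))) = kern a y * Re (exp (\<i> * of_real (l * T * y)) * H_zeta (z y))" for y
    proof -
      have "f y * exp (\<i> * of_real (l * T * y)) = of_real (kern a y) * (exp (\<i> * of_real (l * T * y)) * H_zeta (z y))"
        by (simp add: f_def mult_ac)
      then show ?thesis by (simp only: Re_of_real_mult)
    qed
    ultimately show ?thesis by (simp only: spectral_term_def z_def)
  qed
  ultimately show ?thesis by simp
qed

text \<open>
  The pole and the regular part together bound the weighted sum from below for each \<open>\<delta> > 0\<close>. The
  sum of positive parts is finite, which allows \<open>\<delta>\<close> to tend to 0 without any information on the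
  growth of the Chebyshev function.
\<close>

lemma local_mangoldt_sum_ge:
  assumes a: "a \<ge> 2 * pi" and l: "l > 0" and T: "T \<ge> a / l" and N: "real N \<ge> exp (T + a / l)"
  shows "(\<Sum>n\<le>N. mangoldt n / real n * pos_hat a (l * (ln (real n) - T))) \<ge> spectral_term a l T + (hat_mass a / l - 16 * pi ^ 3 / (a\<^sup>2 * l))"
proof -
  define E where "E = (\<lambda>\<delta>. integral {0..1} (\<lambda>y. kern a y * Re (exp (\<i> * of_real (l * T * y)) * H_zeta (1 + of_real \<delta> + \<i> * of_real (l * y)))))"
  define S where "S = (\<lambda>\<delta>. \<Sum>n\<le>N. mangoldt n * real n powr (- 1 - \<delta>) * pos_hat a (l * (ln (real n) - T)))"
  define R where "R = {s. Re s > 0 \<and> zetaC s \<noteq> 0}"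
  have oR: "open R" and hR: "H_zeta holomorphic_on R" using H_zeta_holomorphic by (auto simp: R_def)
  have zR: "1 + of_real \<delta> + \<i> * of_real (l * y) \<in> R" if "\<delta> \<ge> 0" for \<delta> y
    using zetaC_nonzero[of "1 + of_real \<delta> + \<i> * of_real (l * y)"] that by (simp add: R_def)
  have cH: "continuous_on A (\<lambda>x. H_zeta (1 + of_real (g x) + \<i> * of_real (l * h x)))"
    if "continuous_on A g" "continuous_on A h" "\<And>x. x \<in> A \<Longrightarrow> g x \<ge> 0" for A :: "'a::t2_space set" and g h
    by (rule continuous_on_compose2[OF holomorphic_on_imp_continuous_on[OF hR]])
       (use zR that in \<open>auto intro!: continuous_intros\<close>)
  have ineq: "E \<delta> + (exp (- \<delta> * (T + a / l)) * (hat_mass a / l) - 16 * pi ^ 3 / (a\<^sup>2 * l)) \<le> S \<delta>" if d: "\<delta> > 0" for \<delta>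
  proof -
    define e where "e = (\<lambda>y. exp (\<i> * complex_of_real (l * T * y)))"
    define s where "s = (\<lambda>y. 1 + of_real \<delta> + \<i> * complex_of_real (l * y))"
    have D: "D_mangoldt (s y) = H_zeta (s y) + 1 / (of_real \<delta> + \<i> * of_real (l * y))" for y
      using D_mangoldt_eq_H_zeta[of "s y"] zetaC_nonzero[of "s y"] d by (simp add: s_def)
    have nz: "of_real \<delta> + \<i> * complex_of_real (l * y) \<noteq> 0" for y using d by (auto simp: complex_eq_iff)
    have "integral {0..1} (\<lambda>y. kern a y * Re (e y * D_mangoldt (s y)))
       = integral {0..1} (\<lambda>y. kern a y * Re (e y * H_zeta (s y)) + kern a y * Re (e y / (of_real \<delta> + \<i> * of_real (l * y))))"
      by (simp add: D algebra_simps)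
    also have "\<dots> = E \<delta> + integral {0..1} (\<lambda>y. kern a y * Re (e y / (of_real \<delta> + \<i> * of_real (l * y))))"
      unfolding E_def e_def s_def using d
      by (intro integral_add integrable_continuous_real continuous_intros cH) (use nz in auto)
    finally have eq: "integral {0..1} (\<lambda>y. kern a y * Re (e y * D_mangoldt (s y))) = 
      E \<delta> + integral {0..1} (\<lambda>y. kern a y * Re (e y / (of_real \<delta> + \<i> * of_real (l * y))))" .
    have "E \<delta> + (exp (- \<delta> * (T + a / l)) * (hat_mass a / l) - 16 * pi ^ 3 / (a\<^sup>2 * l)) \<le> integral {0..1} (\<lambda>y. kern a y * Re (e y * D_mangoldt (s y)))"
      using main_term_lower_bound[OF a l d T] eq by (simp add: e_def)
    also have "\<dots> \<le> S \<delta>"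
    proof (rule tendsto_upperbound)
      show "(\<lambda>K. \<Sum>n<K. mangoldt n * real n powr (- 1 - \<delta>) * kern_hat a (l * (ln (real n) - T)))
         \<longlonglongrightarrow> integral {0..1} (\<lambda>y. kern a y * Re (e y * D_mangoldt (s y)))"
        unfolding e_def s_def by (rule mangoldt_kern_hat_sum_tendsto[OF a d])
      show "\<forall>\<^sub>F K in sequentially. (\<Sum>n<K. mangoldt n * real n powr (- 1 - \<delta>) * kern_hat a (l * (ln (real n) - T))) \<le> S \<delta>"
        using eventually_gt_at_top[of N]
      proof eventually_elim
        case (elim K)
        have "(\<Sum>n<K. mangoldt n * real n powr (- 1 - \<delta>) * kern_hat a (l * (ln (real n) - T)))
           \<le> (\<Sum>n<K. mangoldt n * real n powr (- 1 - \<delta>) * pos_hat a (l * (ln (real n) - T)))"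
          by (intro sum_mono mult_left_mono kern_hat_le_pos_hat mult_nonneg_nonneg mangoldt_nonneg) auto
        also have "\<dots> = S \<delta>" unfolding S_def
        proof (rule sum.mono_neutral_right)
          show "\<forall>n\<in>{..<K} - {..N}. mangoldt n * real n powr (- 1 - \<delta>) * pos_hat a (l * (ln (real n) - T)) = 0"
          proof
            fix n assume "n \<in> {..<K} - {..N}"
            then have "exp (T + a / l) < real n" using N by simp
            then have "T + a / l < ln (real n)"
              by (metis exp_gt_zero ln_exp ln_less_cancel_iff order_less_trans)
            then have "a / l < ln (real n) - T" by simp
            then have "a \<le> \<bar>l * (ln (real n) - T)\<bar>" using l by (simp add: field_simps)
            then show "mangoldt n * real n powr (- 1 - \<delta>) * pos_hat a (l * (ln (real n) - T)) = 0"
              by (simp add: pos_hat_outside[OF a])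
          qed
        qed (use elim in auto)
        finally show ?case .
      qed
    qed simp
    finally show ?thesis .
  qed
  have "continuous_on {0..1} E"
  proof -
    have "continuous_on {0..1} (\<lambda>\<delta>. integral (cbox 0 1) (\<lambda>y. kern a y * Re (exp (\<i> * of_real (l * T * y)) * H_zeta (1 + of_real \<delta> + \<i> * of_real (l * y)))))"
      by (rule integral_continuous_on_param)
         (auto simp: case_prod_unfold simp del: of_real_mult intro!: continuous_intros cH)
    then show ?thesis by (simp add: E_def)
  qed
  then have "(E \<longlongrightarrow> E 0) (at 0 within {0..1})" by (simp add: continuous_on_def)
  then have E: "(E \<longlongrightarrow> E 0) (at_right 0)" by (simp add: at_within_Icc_at_right)
  have "((\<lambda>\<delta>. E \<delta> + (exp (- \<delta> * (T + a / l)) * (hat_mass a / l) - 16 * pi ^ 3 / (a\<^sup>2 * l))) \<longlongrightarrow>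
     E 0 + (exp (- 0 * (T + a / l)) * (hat_mass a / l) - 16 * pi ^ 3 / (a\<^sup>2 * l))) (at_right 0)"
    by (intro tendsto_intros E)
  moreover have "(S \<longlongrightarrow> S 0) (at_right 0)"
    unfolding S_def
  proof (rule tendsto_sum)
    fix n
    show "((\<lambda>\<delta>. mangoldt n * real n powr (- 1 - \<delta>) * pos_hat a (l * (ln (real n) - T))) \<longlongrightarrow>
        mangoldt n * real n powr (- 1 - 0) * pos_hat a (l * (ln (real n) - T))) (at_right 0)"
    proof (cases "n = 0")
      case False
      then show ?thesis by (intro tendsto_intros) auto
    qed simp
  qed
  moreover have "\<forall>\<^sub>F \<delta> in at_right 0. E \<delta> + (exp (- \<delta> * (T + a / l)) * (hat_mass a / l) - 16 * pi ^ 3 / (a\<^sup>2 * l)) \<le> S \<delta>"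
    using ineq by (auto simp: eventually_at_filter)
  ultimately have "E 0 + (exp (- 0 * (T + a / l)) * (hat_mass a / l) - 16 * pi ^ 3 / (a\<^sup>2 * l)) \<le> S 0"
    by (intro tendsto_le[of "at_right 0"]) auto
  moreover have "S 0 = (\<Sum>n\<le>N. mangoldt n / real n * pos_hat a (l * (ln (real n) - T)))"
    unfolding S_def by (intro sum.cong refl) (simp add: powr_minus divide_inverse powr_one_gt_zero_iff)
  moreover have "E 0 = spectral_term a l T" by (simp add: E_def spectral_term_def)
  ultimately show ?thesis by simp
qed

section \<open>Chebyshev functions and the product of primes\<close>

text \<open>
  The second Chebyshev function, at natural arguments.
\<close>

definition psi :: "nat \<Rightarrow> real" where
  "psi N = (\<Sum>n\<le>N. mangoldt n)"

text \<open>
  The local bound is multiplied by \<open>exp t\<close> and integrated over \<open>t \<le> ln N - a / l\<close>. Each \<open>n \<le> N\<close> then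
  contributes at most \<open>exp (a / l) * hat_mass a / l\<close> times its von Mangoldt weight, and larger \<open>n\<close>
  do not contribute.
\<close>

lemma psi_ge_of_local:
  assumes a: "a \<ge> 2 * pi" and l: "l > 0" and q: "q < hat_mass a / l - 16 * pi ^ 3 / (a\<^sup>2 * l)"
  obtains C where "\<forall>\<^sub>F N in sequentially. q * (real N * exp (- (a / l)) - C) \<le> psi N * (exp (a / l) * (hat_mass a / l))"
proof -
  define \<alpha> where "\<alpha> = a / l"
  have a0: "a > 0" using a pi_gt_zero by linarith
  have al: "\<alpha> > 0" using a0 l by (simp add: \<alpha>_def)
  have "\<forall>\<^sub>F T in at_top. spectral_term a l T > q - (hat_mass a / l - 16 * pi ^ 3 / (a\<^sup>2 * l))"
    using spectral_term_tendsto_0[OF l] by (rule order_tendstoD) (use q in simp)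
  then obtain T0 where T0: "\<And>T. T \<ge> T0 \<Longrightarrow> spectral_term a l T > q - (hat_mass a / l - 16 * pi ^ 3 / (a\<^sup>2 * l))"
    by (auto simp: eventually_at_top_linorder)
  define t0 where "t0 = max T0 \<alpha>"
  define S where "S = (\<lambda>N t. \<Sum>n\<le>N. mangoldt n / real n * pos_hat a (l * (ln (real n) - t)))"
  have S: "q \<le> S N t" if "t \<ge> t0" "real N \<ge> exp (t + \<alpha>)" for N t
    using local_mangoldt_sum_ge[OF a l, of t N] T0[of t] that unfolding S_def t0_def \<alpha>_def by auto
  have "q * (real N * exp (- \<alpha>) - exp t0) \<le> psi N * (exp \<alpha> * (hat_mass a / l))" if N: "real N \<ge> exp (t0 + \<alpha>)" for N
  proof -
    define T where "T = ln (real N)"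
    have "real N > 0" using N exp_gt_zero[of "t0 + \<alpha>"] by linarith
    then have T: "exp T = real N" by (simp add: T_def)
    then have "exp (t0 + \<alpha>) \<le> exp T" using N by simp
    then have tT: "t0 \<le> T - \<alpha>" by simp
    have "((\<lambda>t. exp t * q) has_integral (exp (T - \<alpha>) * q - exp t0 * q)) {t0..T - \<alpha>}"
      using tT by (intro fundamental_theorem_of_calculus)
         (auto simp flip: has_real_derivative_iff_has_vector_derivative intro!: derivative_eq_intros)
    moreover have "((\<lambda>t. exp t * S N t) has_integral integral {t0..T - \<alpha>} (\<lambda>t. exp t * S N t)) {t0..T - \<alpha>}"
      unfolding S_def by (intro integrable_integral integrable_continuous_real continuous_intros)
    moreover have "exp t * q \<le> exp t * S N t" if "t \<in> {t0..T - \<alpha>}" for t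
    proof (intro mult_left_mono S)
      have "exp (t + \<alpha>) \<le> exp T" using that by simp
      then show "exp (t + \<alpha>) \<le> real N" by (simp add: T)
    qed (use that in auto)
    ultimately have "exp (T - \<alpha>) * q - exp t0 * q \<le> integral {t0..T - \<alpha>} (\<lambda>t. exp t * S N t)"
      by (rule has_integral_le)
    also have "integral {t0..T - \<alpha>} (\<lambda>t. exp t * S N t) =
       integral {t0..T - \<alpha>} (\<lambda>t. \<Sum>n\<le>N. mangoldt n / real n * (exp t * pos_hat a (l * (t - ln (real n)))))"
    proof (rule integral_cong)
      fix t
      have "pos_hat a (l * (ln (real n) - t)) = pos_hat a (l * (t - ln (real n)))" for n
        using pos_hat_minus[of a "l * (t - ln (real n))"] by (simp only: minus_mult_right minus_diff_eq)
      then show "exp t * S N t = (\<Sum>n\<le>N. mangoldt n / real n * (exp t * pos_hat a (l * (t - ln (real n)))))"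
        unfolding S_def sum_distrib_left by (intro sum.cong refl) simp
    qed
    also have "\<dots> = (\<Sum>n\<le>N. integral {t0..T - \<alpha>} (\<lambda>t. mangoldt n / real n * (exp t * pos_hat a (l * (t - ln (real n))))))"
      by (intro integral_sum integrable_continuous_real continuous_intros) auto
    also have "\<dots> \<le> (\<Sum>n\<le>N. mangoldt n * (exp \<alpha> * (hat_mass a / l)))"
    proof (rule sum_mono)
      fix n
      show "integral {t0..T - \<alpha>} (\<lambda>t. mangoldt n / real n * (exp t * pos_hat a (l * (t - ln (real n))))) \<le> mangoldt n * (exp \<alpha> * (hat_mass a / l))"
      proof (cases "n = 0")
        case False
        define u where "u = ln (real n)"
        define p r where "p = min t0 (u - \<alpha>)" and "r = max (T - \<alpha>) (u + \<alpha>)"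
        have eu: "exp u = real n" using False by (simp add: u_def)
        have *: "((\<lambda>t. real n * exp \<alpha> * pos_hat a (l * (t - u))) has_integral real n * exp \<alpha> * (hat_mass a / l)) {p..r}"
          by (intro has_integral_mult_right pos_hat_scaled_has_integral a l) (auto simp: p_def r_def \<alpha>_def)
        have "integral {t0..T - \<alpha>} (\<lambda>t. exp t * pos_hat a (l * (t - u))) \<le> integral {t0..T - \<alpha>} (\<lambda>t. real n * exp \<alpha> * pos_hat a (l * (t - u)))"
        proof (rule integral_le)
          fix t
          show "exp t * pos_hat a (l * (t - u)) \<le> real n * exp \<alpha> * pos_hat a (l * (t - u))"
          proof (cases "t \<le> u + \<alpha>")
            case True
            then have "exp t \<le> exp (u + \<alpha>)" by simp
            then show ?thesis by (intro mult_right_mono) (auto simp: exp_add eu)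
          next
            case False
            then have "a \<le> \<bar>l * (t - u)\<bar>" using l by (simp add: \<alpha>_def field_simps)
            then show ?thesis by (simp add: pos_hat_outside[OF a])
          qed
        qed (intro integrable_continuous_real continuous_intros)+
        also have "\<dots> \<le> integral {p..r} (\<lambda>t. real n * exp \<alpha> * pos_hat a (l * (t - u)))"
          by (intro integral_subset_le integrable_continuous_real continuous_intros)
             (auto simp: p_def r_def)
        also have "\<dots> = real n * exp \<alpha> * (hat_mass a / l)" using * by (rule integral_unique)
        finally have "mangoldt n / real n * integral {t0..T - \<alpha>} (\<lambda>t. exp t * pos_hat a (l * (t - u))) \<le> mangoldt n / real n * (real n * exp \<alpha> * (hat_mass a / l))"
          by (intro mult_left_mono) (auto simp: mangoldt_nonneg)
        then show ?thesis using False by (simp add: u_def)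
      qed simp
    qed
    also have "\<dots> = psi N * (exp \<alpha> * (hat_mass a / l))" unfolding psi_def by (rule sum_distrib_right[symmetric])
    also have "exp (T - \<alpha>) * q - exp t0 * q = q * (real N * exp (- \<alpha>) - exp t0)"
      by (simp add: exp_diff exp_minus T field_simps)
    finally show ?thesis .
  qed
  moreover have "\<forall>\<^sub>F N in sequentially. real N \<ge> exp (t0 + \<alpha>)"
    using filterlim_real_sequentially by (simp add: filterlim_at_top)
  ultimately have "\<forall>\<^sub>F N in sequentially. q * (real N * exp (- \<alpha>) - exp t0) \<le> psi N * (exp \<alpha> * (hat_mass a / l))"
    by (auto elim: eventually_mono)
  then show ?thesis using that unfolding \<alpha>_def by blast
qed

lemma psi_lower_bound:
  assumes e: "\<epsilon> > 0"
  shows "\<forall>\<^sub>F N in sequentially. psi N \<ge> (1 - \<epsilon>) * real N"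
proof -
  \<comment> \<open>First a large a makes the negative part of the transform negligible, then a large l makes the width a / l of the window small.\<close>
  define \<eta> where "\<eta> = min \<epsilon> 1 / 8"
  have \<eta>: "0 < \<eta>" "\<eta> \<le> 1 / 8" "8 * \<eta> \<le> \<epsilon>" using e by (auto simp: \<eta>_def)
  have "((\<lambda>a. 16 * pi ^ 3 / a\<^sup>2) \<longlongrightarrow> 0) at_top" by real_asymp
  then have "\<forall>\<^sub>F a in at_top. 16 * pi ^ 3 / a\<^sup>2 < \<eta> * (3 / pi\<^sup>2)"
    by (rule order_tendstoD) (use \<eta> in simp)
  then have "\<forall>\<^sub>F a in at_top. 16 * pi ^ 3 / a\<^sup>2 < \<eta> * (3 / pi\<^sup>2) \<and> a \<ge> 2 * pi"
    using eventually_ge_at_top by (rule eventually_conj)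
  then obtain a where a: "16 * pi ^ 3 / a\<^sup>2 < \<eta> * (3 / pi\<^sup>2)" "a \<ge> 2 * pi"
    by (auto simp: eventually_at_top_linorder)
  have "((\<lambda>l. exp (- (a / l))) \<longlongrightarrow> 1) at_top" by real_asymp
  then have "\<forall>\<^sub>F l in at_top. 1 - \<eta> < exp (- (a / l))"
    by (rule order_tendstoD) (use \<eta> in simp)
  then have "\<forall>\<^sub>F l in at_top. 1 - \<eta> < exp (- (a / l)) \<and> l > 0"
    using eventually_gt_at_top by (rule eventually_conj)
  then obtain l where l: "1 - \<eta> < exp (- (a / l))" "l > 0"
    by (auto simp: eventually_at_top_linorder)
  define x where "x = exp (- (a / l))"
  have hat_mass: "hat_mass a \<ge> 3 / pi\<^sup>2" by (rule hat_mass_ge[OF a(2)])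
  moreover have "3 / pi\<^sup>2 > 0" by simp
  ultimately have J0: "hat_mass a > 0" by linarith
  have "\<eta> * (3 / pi\<^sup>2) \<le> \<eta> * hat_mass a" using hat_mass \<eta> by (intro mult_left_mono) auto
  then have "16 * pi ^ 3 / a\<^sup>2 < \<eta> * hat_mass a" using a(1) by linarith
  then have "16 * pi ^ 3 / a\<^sup>2 / l < \<eta> * hat_mass a / l" using l(2) by (rule divide_strict_right_mono)
  then have "(1 - \<eta>) * (hat_mass a / l) < hat_mass a / l - 16 * pi ^ 3 / (a\<^sup>2 * l)"
    by (simp add: left_diff_distrib diff_divide_distrib)
  from psi_ge_of_local[OF a(2) l(2) this] obtain C where
    C: "\<forall>\<^sub>F N in sequentially. (1 - \<eta>) * (hat_mass a / l) * (real N * x - C) \<le> psi N * (exp (a / l) * (hat_mass a / l))"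
    unfolding x_def by blast
  have "\<forall>\<^sub>F N in sequentially. real N \<ge> \<bar>C\<bar> / \<eta>"
    using filterlim_real_sequentially by (simp add: filterlim_at_top)
  with C show ?thesis
  proof eventually_elim
    case (elim N)
    have ex: "exp (a / l) = 1 / x" by (simp add: x_def exp_minus field_simps)
    have x: "x > 0" "1 - \<eta> < x" using l by (auto simp: x_def)
    have Jl: "hat_mass a / l > 0" using J0 l by simp
    have "((1 - \<eta>) * (real N * x - C)) * (hat_mass a / l) \<le> (psi N / x) * (hat_mass a / l)"
      using elim(1) by (simp add: ex mult_ac)
    then have "(1 - \<eta>) * (real N * x - C) \<le> psi N / x" using Jl by (simp only: mult_le_cancel_right_pos)
    then have 1: "x * ((1 - \<eta>) * (real N * x - C)) \<le> psi N" using x by (simp add: field_simps)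
    have "C \<le> \<eta> * real N" using elim(2) \<eta> by (simp add: field_simps)
    moreover have "(1 - \<eta>) * real N \<le> x * real N" using x by (intro mult_right_mono) auto
    ultimately have "(1 - 2 * \<eta>) * real N \<le> real N * x - C" by (simp add: algebra_simps)
    then have "(1 - \<eta>) * ((1 - \<eta>) * ((1 - 2 * \<eta>) * real N)) \<le> x * ((1 - \<eta>) * (real N * x - C))"
      using \<eta> x by (intro mult_mono mult_nonneg_nonneg) auto
    with 1 have "((1 - \<eta>) * (1 - \<eta>) * (1 - 2 * \<eta>)) * real N \<le> psi N" by (simp add: mult_ac)
    moreover have "(1 - \<epsilon>) * real N \<le> ((1 - \<eta>) * (1 - \<eta>) * (1 - 2 * \<eta>)) * real N"
    proof (rule mult_right_mono)
      have "(1 - \<eta>) * (1 - \<eta>) \<ge> 1 - 2 * \<eta>" by (simp add: algebra_simps)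
      then have "(1 - \<eta>) * (1 - \<eta>) * (1 - 2 * \<eta>) \<ge> (1 - 2 * \<eta>) * (1 - 2 * \<eta>)"
        using \<eta> by (intro mult_right_mono) auto
      moreover have "(1 - 2 * \<eta>) * (1 - 2 * \<eta>) \<ge> 1 - 4 * \<eta>" by (simp add: algebra_simps)
      ultimately show "1 - \<epsilon> \<le> (1 - \<eta>) * (1 - \<eta>) * (1 - 2 * \<eta>)" using \<eta> by linarith
    qed simp
    ultimately show ?case by linarith
  qed
qed

text \<open>
  The first Chebyshev function, at natural arguments.
\<close>

definition theta :: "nat \<Rightarrow> real" where
  "theta N = (\<Sum>p | p \<le> N \<and> prime p. ln (real p))"

text \<open>
  A proper prime power \<open>p ^ k \<le> N\<close> has \<open>p \<le> sqrt N\<close> and \<open>k \<le> log 2 N\<close>.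
\<close>

lemma psi_minus_theta_le:
  assumes N: "N \<ge> 1"
  shows "psi N - theta N \<le> (sqrt (real N) + 1) * (log 2 (real N) + 1) * ln (real N)"
proof -
  define B where "B = {n. n \<le> N \<and> primepow n \<and> \<not> prime n}"
  define Q where "Q = {n. n \<le> N \<and> prime n}"
  have fin: "finite B" "finite Q" by (auto simp: B_def Q_def)
  have "psi N = (\<Sum>n\<in>B \<union> Q. mangoldt n)"
    unfolding psi_def by (rule sum.mono_neutral_right) (auto simp: B_def Q_def mangoldt_def)
  also have "\<dots> = (\<Sum>n\<in>B. mangoldt n) + (\<Sum>n\<in>Q. mangoldt n)"
    using fin by (intro sum.union_disjoint) (auto simp: B_def Q_def)
  also have "(\<Sum>n\<in>Q. mangoldt n) = theta N"
    unfolding theta_def Q_def by (intro sum.cong) auto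
  finally have "psi N - theta N = (\<Sum>n\<in>B. mangoldt n)" by simp
  also have "\<dots> \<le> (\<Sum>n\<in>B. ln (real N))"
  proof (rule sum_mono)
    fix n assume n: "n \<in> B"
    then have "n > 0" by (auto simp: B_def intro!: Nat.gr0I)
    have "mangoldt n \<le> ln (real n)" by (rule mangoldt_le_ln)
    also have "\<dots> \<le> ln (real N)" using n \<open>n > 0\<close> by (simp add: B_def)
    finally show "mangoldt n \<le> ln (real N)" .
  qed
  also have "\<dots> = real (card B) * ln (real N)" by simp
  also have "\<dots> \<le> (sqrt (real N) + 1) * (log 2 (real N) + 1) * ln (real N)"
  proof (rule mult_right_mono)
    define R where "R = nat \<lfloor>sqrt (real N)\<rfloor>"
    define L where "L = nat \<lfloor>log 2 (real N)\<rfloor>"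
    have "B \<subseteq> (\<lambda>(p, k). p ^ k) ` ({..R} \<times> {..L})"
    proof
      fix n assume n: "n \<in> B"
      then obtain p k where pk: "prime p" "k > 0" "n = p ^ k"
        by (auto simp: B_def primepow_def)
      have "k \<noteq> 1" using n pk by (auto simp: B_def)
      then have k: "k \<ge> 2" using pk by simp
      have p2: "p \<ge> 2" using pk(1) by (rule prime_ge_2_nat)
      have nN: "n \<le> N" using n by (simp add: B_def)
      have "p ^ 2 \<le> p ^ k" using k p2 by (intro power_increasing) auto
      then have "p ^ 2 \<le> N" using nN pk(3) by simp
      then have "real (p ^ 2) \<le> real N" by (rule of_nat_mono)
      then have "real p ^ 2 \<le> real N" by simp
      then have "real p \<le> sqrt (real N)" by (rule real_le_rsqrt)
      then have "p \<le> R" unfolding R_def by (simp add: le_nat_floor)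
      have "2 ^ k \<le> p ^ k" using p2 by (intro power_mono) auto
      then have "(2::nat) ^ k \<le> N" using nN pk(3) by simp
      then have "real (2 ^ k) \<le> real N" by (rule of_nat_mono)
      then have "2 powr real k \<le> real N" by (simp add: powr_realpow)
      then have "real k \<le> log 2 (real N)" using N by (simp add: le_log_iff)
      then have "k \<le> L" unfolding L_def by (simp add: le_nat_floor)
      with \<open>p \<le> R\<close> pk show "n \<in> (\<lambda>(p, k). p ^ k) ` ({..R} \<times> {..L})" by auto
    qed
    then have "card B \<le> card ((\<lambda>(p::nat, k). p ^ k) ` ({..R} \<times> {..L}))"
      by (intro card_mono) auto
    also have "\<dots> \<le> card ({..R} \<times> {..L})" by (rule card_image_le) auto
    also have "\<dots> = (R + 1) * (L + 1)" by simp
    finally have "real (card B) \<le> real ((R + 1) * (L + 1))" by (rule of_nat_mono)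
    also have "\<dots> = (real R + 1) * (real L + 1)" by (simp add: algebra_simps)
    also have "\<dots> \<le> (sqrt (real N) + 1) * (log 2 (real N) + 1)"
      using N by (intro mult_mono) (auto simp: R_def L_def)
    finally show "real (card B) \<le> (sqrt (real N) + 1) * (log 2 (real N) + 1)" .
  qed (use N in auto)
  finally show ?thesis .
qed

lemma theta_lower_bound:
  assumes e: "\<epsilon> > 0"
  shows "\<forall>\<^sub>F N in sequentially. theta N \<ge> (1 - \<epsilon>) * real N"
proof -
  have "\<forall>\<^sub>F N in sequentially. (sqrt (real N) + 1) * (log 2 (real N) + 1) * ln (real N) \<le> (\<epsilon> / 2) * real N"
    using e by real_asymp
  moreover have "\<forall>\<^sub>F N in sequentially. psi N \<ge> (1 - \<epsilon> / 2) * real N"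
    using e by (intro psi_lower_bound) auto
  ultimately show ?thesis using eventually_ge_at_top[of 1]
  proof eventually_elim
    case (elim N)
    then show ?case using psi_minus_theta_le[of N] by (simp add: algebra_simps)
  qed
qed

lemma sum_ln_nth_prime:
  assumes "m \<ge> 1"
  shows "(\<Sum>j=1..m. ln (real (nth_prime j))) = theta (nth_prime m)"
proof -
  have inj: "inj_on nth_prime {1..m}"
    using strict_mono_on_imp_inj_on[OF strict_mono_on_nth_prime] by (rule inj_on_subset) auto
  have "nth_prime ` {1..m} = {p. p \<le> nth_prime m \<and> prime p}"
  proof (intro equalityI subsetI)
    fix p assume "p \<in> nth_prime ` {1..m}"
    then obtain j where "p = nth_prime j" "1 \<le> j" "j \<le> m" by auto
    then show "p \<in> {p. p \<le> nth_prime m \<and> prime p}"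
      using strict_mono_on_leD[OF strict_mono_on_nth_prime, of j m] by (auto simp: prime_nth_prime)
  next
    fix p assume p: "p \<in> {p. p \<le> nth_prime m \<and> prime p}"
    then have "p \<in> nth_prime ` {1..}" unfolding nth_prime_image by simp
    then obtain j where j: "p = nth_prime j" "1 \<le> j" by auto
    have "j \<le> m"
    proof (rule ccontr)
      assume "\<not> j \<le> m"
      then have "nth_prime m < nth_prime j"
        using assms j by (intro strict_mono_onD[OF strict_mono_on_nth_prime]) auto
      then show False using p j by simp
    qed
    with j show "p \<in> nth_prime ` {1..m}" by auto
  qed
  then have "theta (nth_prime m) = sum (\<lambda>p. ln (real p)) (nth_prime ` {1..m})" by (simp add: theta_def)
  also have "\<dots> = (\<Sum>j=1..m. ln (real (nth_prime j)))" unfolding sum.reindex[OF inj] by simp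
  finally show ?thesis by simp
qed

lemma nth_prime_ge: "nth_prime m \<ge> m"
proof -
  have "enumerate {p::nat. prime p} n > n" for n
  proof (induction n)
    case 0
    have "prime (enumerate {p::nat. prime p} 0)" using enumerate_in_set[OF primes_infinite] by auto
    then show ?case by (rule prime_gt_0_nat)
  next
    case (Suc n)
    have "enumerate {p::nat. prime p} n < enumerate {p::nat. prime p} (Suc n)"
      by (rule enumerate_step[OF primes_infinite])
    then show ?case using Suc by simp
  qed
  from this[of "m - 1"] show ?thesis by (simp add: nth_prime_def)
qed

theorem corollary1:
  fixes c :: real and k :: nat
  assumes "1 < c" and "c < exp 1"
  shows "\<exists>N::nat. \<forall>n::nat. n \<ge> 1 \<and> n \<ge> N \<longrightarrow>
           real (\<Prod>j=1..n. nth_prime j) > c ^ nth_prime (n + k)"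
proof -
  \<comment> \<open>With this choice 1 - 2 \<epsilon> is ln c, which leaves one \<epsilon> for the Chebyshev function and one for the last k primes.\<close>
  define \<epsilon> where "\<epsilon> = (1 - ln c) / 2"
  have "ln c < ln (exp 1)" using assms by (subst ln_less_cancel_iff) auto
  then have e: "\<epsilon> > 0" by (simp add: \<epsilon>_def)
  have "\<forall>\<^sub>F N in sequentially. real k * ln (real N) < \<epsilon> * real N" using e by real_asymp
  with theta_lower_bound[OF e]
  have "\<forall>\<^sub>F N in sequentially. theta N - real k * ln (real N) > (1 - 2 * \<epsilon>) * real N"
    by eventually_elim (simp add: algebra_simps)
  then obtain N where N: "\<And>x. x \<ge> N \<Longrightarrow> theta x - real k * ln (real x) > (1 - 2 * \<epsilon>) * real x"
    by (auto simp: eventually_at_top_linorder)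
  have "real (\<Prod>j=1..n. nth_prime j) > c ^ nth_prime (n + k)" if n: "n \<ge> 1" "n \<ge> N" for n
  proof -
    define x where "x = nth_prime (n + k)"
    have pos: "real (nth_prime j) > 0" for j
      using prime_gt_0_nat[OF prime_nth_prime[of j]] by simp
    have "x \<ge> N" using n nth_prime_ge[of "n + k"] by (simp add: x_def)
    \<comment> \<open>Passing from n + k to n factors costs at most k ln x in the logarithm.\<close>
    have "(\<Sum>j=1..n + k. ln (real (nth_prime j))) = (\<Sum>j=1..n. ln (real (nth_prime j))) + (\<Sum>j=n+1..n + k. ln (real (nth_prime j)))"
      using n by (subst sum.ub_add_nat) auto
    moreover have "(\<Sum>j=n+1..n + k. ln (real (nth_prime j))) \<le> (\<Sum>j=n+1..n + k. ln (real x))"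
    proof (rule sum_mono)
      fix j assume "j \<in> {n+1..n+k}"
      then have "nth_prime j \<le> x"
        unfolding x_def by (intro strict_mono_on_leD[OF strict_mono_on_nth_prime]) auto
      then show "ln (real (nth_prime j)) \<le> ln (real x)" using pos[of j] by simp
    qed
    moreover have "(\<Sum>j=1..n + k. ln (real (nth_prime j))) = theta x"
      unfolding x_def using n by (intro sum_ln_nth_prime) auto
    ultimately have "(\<Sum>j=1..n. ln (real (nth_prime j))) \<ge> theta x - real k * ln (real x)" by simp
    moreover have "(\<Sum>j=1..n. ln (real (nth_prime j))) = ln (real (\<Prod>j=1..n. nth_prime j))"
      using pos by (subst ln_prod[symmetric]) auto
    moreover have "(1 - 2 * \<epsilon>) * real x = ln (c ^ x)"
    proof -
      have "1 - 2 * \<epsilon> = ln c" unfolding \<epsilon>_def by (simp add: field_simps)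
      then show ?thesis using assms by (simp add: ln_realpow)
    qed
    ultimately have "ln (c ^ x) < ln (real (\<Prod>j=1..n. nth_prime j))" using N[OF \<open>x \<ge> N\<close>] by linarith
    moreover have "real (\<Prod>j=1..n. nth_prime j) > 0"
      unfolding of_nat_prod using pos by (intro prod_pos) auto
    moreover have "c ^ x > 0" using assms by simp
    ultimately show ?thesis by (simp only: ln_less_cancel_iff x_def)
  qed
  then show ?thesis by blast
qed

end
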